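(* Let $a\ge 3$ be an integer and put $A=\{1,2,a\}$. (1) If $a\not\equiv 2\pmod 4$, then the Diophantine equation $P_A(m)=P_4(n)$ has infinitely many solutions $(m,n)$ in positive integers. (2) If $a\equiv 2\pmod 4$, then the Diophantine equation $P_A(m)=P_4(n)$ has only finitely many solutions in integers $m,n\ge 0$.
   Context: For a set $A$ of positive integers and a non-negative integer $n$, $P_A(n)$ denotes the number of partitions of $n$ into parts from $A$ (repetitions allowed, order of parts disregarded); $P_A(0)=1$. Equivalently, $\prod_{a\in A}\frac{1}{1-x^a}=\sum_{n=0}^\infty P_A(n)x^n$. For a positive integer $k$, $P_k:=P_{\{1,2,\dots,k\}}$, so $P_4=P_{\{1,2,3,4\}}$. *)

theory Defs
  imports Complex_Main "HOL-Library.Multiset" "HOL-Number_Theory.Cong"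
begin

(* A partition of n into parts from A is the finite multiset of its parts.  For 0 \<notin> A there are
   only finitely many of them; if 0 \<in> A, card may return its default value 0. *)
definition partition_count :: "nat set \<Rightarrow> nat \<Rightarrow> nat" where
  "partition_count A n = card {M :: nat multiset. set_mset M \<subseteq> A \<and> sum_mset M = n}"

definition partition_count_upto :: "nat \<Rightarrow> nat \<Rightarrow> nat" where
  "partition_count_upto k = partition_count {1..k}"

end

theory Submission
  imports Defs "HOL-Computational_Algebra.Polynomial" "HOL-Library.FuncSet"
begin

text \<open>With \<open>X = n + 5\<close> the number \<open>144 P\<^sub>4(n)\<close> is \<open>X^3 - 3X + c\<close> or \<open>X^3 - 12X + c\<close>, where \<open>c\<close> depends only
  on \<open>n mod 12\<close>, while a multiple of \<open>P\<^sub>A(m)\<close> plus one of finitely many constants is a square, so the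
  equation describes finitely many cubic curves. If \<open>a\<close> is not congruent to \<open>2\<close> modulo \<open>4\<close>, one of
  them is the singular curve \<open>(X - 2)^2 (X + 4) = 144 a Q^2\<close>, which yields a parametric family of solutions.
  If \<open>a = 2b\<close> with \<open>b\<close> odd, a parity argument shows that all curves are nonsingular, and finiteness
  follows as in Mordell's proof: an integral point \<open>(x, y)\<close> of \<open>y^2 = 4x^3 - g\<^sub>2 x - g\<^sub>3\<close> gives the
  binary quartic form \<open>X^4 - 6x X^2 Y^2 + 4y X Y^3 + (g\<^sub>2 - 3x^2) Y^4\<close> with invariants \<open>g\<^sub>2\<close> and \<open>g\<^sub>3\<close>,
  which represents \<open>1\<close>. It is equivalent over \<open>SL\<^sub>2(\<int>)\<close> to one of finitely many forms \<open>h\<close>, the equation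
  \<open>h = 1\<close> has finitely many solutions by Thue's theorem, and \<open>x\<close> is recovered from such a solution by
  means of the Hessian of \<open>h\<close>.\<close>

section \<open>Counting partitions\<close>

text \<open>The split modulo 4 is 2-adic: a square of \<open>Q\<close> alone, as on the singular
  curve, needs a residue class of \<open>m\<close> on which \<open>P_A(m)\<close> is exactly
  \<open>a\<close> times a square, and such a class is ruled out by parity when
  \<open>a = 2 b\<close> with \<open>b\<close> odd. On nonsingular curves the difficulty is the
  approximation exponent. A solution of a quartic Thue equation makes \<open>p / q\<close>
  approximate a root with error \<open>O(q^-4)\<close>, which Liouville's bound just fails to
  exclude. Thue's exponent, anything above \<open>d / 2 + 1\<close>, does exclude it, and the gap
  between 3 and 4 leaves room for crude constants. The price is that two very good approximations
  have to be played against each other, so no bound on the solutions results. The passage to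
  finitely many forms avoids the general reduction theory of quartics: over the reals each form that
  arises with \<open>x\<close> positive and \<open>y\<close> nonpositive is a unimodular
  substitution away from one with bounded coefficients, so it suffices to reduce a planar
  lattice.\<close>

lemma size_le_sum_mset: "0 \<notin># M \<Longrightarrow> size M \<le> sum_mset (M :: nat multiset)"
proof (induction M)
  case (add x M)
  then have "size M \<le> sum_mset M" "x \<noteq> 0" by auto
  then show ?case by simp
qed simp

lemma finite_partitions:
  assumes "0 \<notin> A"
  shows "finite {M :: nat multiset. set_mset M \<subseteq> A \<and> sum_mset M = n}"
proof (rule finite_subset)
  show "{M :: nat multiset. set_mset M \<subseteq> A \<and> sum_mset M = n}
    \<subseteq> mset ` {xs. set xs \<subseteq> {..n} \<and> length xs \<le> n}"
  proof
    fix M :: "nat multiset" assume M: "M \<in> {M. set_mset M \<subseteq> A \<and> sum_mset M = n}"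
    obtain xs where xs: "M = mset xs" by (metis ex_mset)
    have "size M \<le> n" using M assms size_le_sum_mset[of M] by auto
    moreover have "x \<le> n" if "x \<in># M" for x
      using sum_mset.remove[OF that] M by auto
    ultimately show "M \<in> mset ` {xs. set xs \<subseteq> {..n} \<and> length xs \<le> n}"
      by (auto simp: xs)
  qed
  show "finite (mset ` {xs. set xs \<subseteq> {..n} \<and> length xs \<le> n})"
    by (intro finite_imageI finite_lists_length_le) auto
qed

lemma partition_count_empty: "partition_count {} n = (if n = 0 then 1 else 0)"
proof -
  have "{M :: nat multiset. set_mset M \<subseteq> {} \<and> sum_mset M = n} = (if n = 0 then {{#}} else {})"
    by auto
  then show ?thesis by (simp add: partition_count_def)
qed

lemma partition_count_insert:
  assumes "0 \<notin> A" "a > 0" "a \<notin> A"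
  shows "partition_count (insert a A) n =
    partition_count A n + (if a \<le> n then partition_count (insert a A) (n - a) else 0)"
proof -
  define S where "S B n = {M :: nat multiset. set_mset M \<subseteq> B \<and> sum_mset M = n}" for B n
  define T where "T = (if a \<le> n then add_mset a ` S (insert a A) (n - a) else {})"
  have fin: "finite (S B k)" if "0 \<notin> B" for B k
    using finite_partitions[OF that] by (simp add: S_def)
  have "M \<in> S A n \<union> T" if M: "M \<in> S (insert a A) n" for M
  proof (cases "a \<in># M")
    case True
    then obtain K where K: "M = add_mset a K" by (metis insert_DiffM)
    then have "a + sum_mset K = n" "set_mset K \<subseteq> insert a A" using M by (auto simp: S_def)
    then show ?thesis using K by (auto simp: T_def S_def)
  next
    case False
    then show ?thesis using M by (auto simp: S_def)
  qed
  moreover have "S A n \<union> T \<subseteq> S (insert a A) n" by (auto simp: S_def T_def)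
  ultimately have "S (insert a A) n = S A n \<union> T" by blast
  moreover have "S A n \<inter> T = {}"
  proof -
    have "a \<notin># M" if "M \<in> S A n" for M using that assms(3) by (auto simp: S_def)
    then show ?thesis by (force simp: T_def)
  qed
  moreover have "finite T" using fin[of "insert a A"] assms(1,2) by (simp add: T_def)
  ultimately have "card (S (insert a A) n) = card (S A n) + card T"
    using fin assms by (simp add: card_Un_disjoint)
  moreover have "card T = (if a \<le> n then card (S (insert a A) (n - a)) else 0)"
    by (auto simp: T_def intro!: card_image inj_onI)
  ultimately show ?thesis by (simp add: S_def partition_count_def)
qed

lemma partition_count_insert_less:
  assumes "0 \<notin> A" "a \<notin> A" "n < a"
  shows "partition_count (insert a A) n = partition_count A n"
  using partition_count_insert[of A a n] assms by simp

lemma partition_count_insert_add: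
  assumes "0 \<notin> A" "a \<notin> A" "a > 0"
  shows "partition_count (insert a A) (n + a) =
    partition_count A (n + a) + partition_count (insert a A) n"
  using partition_count_insert[of A a "n + a"] assms by simp

lemma partition_count_1: "partition_count {1} n = 1"
  by (induction n)
    (use partition_count_insert[of "{}" 1] in \<open>simp_all add: partition_count_empty\<close>)

lemma partition_count_12: "partition_count {1, 2} n = n div 2 + 1"
proof (induction n rule: less_induct)
  case (less n)
  have "partition_count {1, 2} n = 1 + (if 2 \<le> n then partition_count {1, 2} (n - 2) else 0)"
    using partition_count_insert[of "{1}" 2 n] partition_count_1 by (simp add: insert_commute)
  then show ?case using less[of "n - 2"] by auto
qed

section \<open>Quasi-polynomials for the parts 1, 2 and \<open>a\<close>\<close>

context
  fixes a :: nat
  assumes a: "a \<ge> 3"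
begin

lemma partition_count_12a_less: "n < a \<Longrightarrow> partition_count {1, 2, a} n = n div 2 + 1"
  using partition_count_insert_less[of "{1,2}" a n] a partition_count_12 by (simp add: insert_commute)

lemma partition_count_12a_add:
  "partition_count {1, 2, a} (n + a) = (n + a) div 2 + 1 + partition_count {1, 2, a} n"
  using partition_count_insert_add[of "{1,2}" a n] a partition_count_12 by (simp add: insert_commute)

lemma partition_count_12a_ge: "n div 2 + 1 \<le> partition_count {1, 2, a} n"
proof (cases "n < a")
  case False
  then show ?thesis using partition_count_12a_add[of "n - a"] by simp
qed (simp add: partition_count_12a_less del: One_nat_def)

text \<open>The residue \<open>r\<close> is chosen so that the linear term of the quasi-polynomial vanishes.\<close>

lemma partition_count_12a_square:
  assumes "r < a" "r div 2 + (r + a) div 2 + 2 = a"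
  shows "partition_count {1, 2, a} (2 * a * Q + a + r) = a * (Q + 1)\<^sup>2"
proof (induction Q)
  case 0
  then show ?case using partition_count_12a_add[of r] partition_count_12a_less[of r] assms
    by (simp add: add_ac)
next
  case (Suc Q)
  let ?m = "2 * a * Q + a + r"
  have e: "(?m + a + a) div 2 = (r + a) div 2 + a * (Q + 1)" "(?m + a) div 2 = r div 2 + a * (Q + 1)"
  proof -
    have "?m + a + a = (r + a) + 2 * (a * (Q + 1))" "?m + a = r + 2 * (a * (Q + 1))" by simp_all
    then show "(?m + a + a) div 2 = (r + a) div 2 + a * (Q + 1)" "(?m + a) div 2 = r div 2 + a * (Q + 1)"
      by (metis add.commute div_mult_self1 mult.commute zero_neq_numeral)+
  qed
  have "2 * a * Suc Q + a + r = ?m + a + a" by simp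
  then have "partition_count {1, 2, a} (2 * a * Suc Q + a + r) = partition_count {1, 2, a} (?m + a + a)"
    by (rule arg_cong)
  also have "\<dots> = (?m + a + a) div 2 + 1 + ((?m + a) div 2 + 1 + a * (Q + 1)\<^sup>2)"
    by (simp only: partition_count_12a_add Suc)
  also have "\<dots> = (r div 2 + (r + a) div 2 + 2) + 2 * a * (Q + 1) + a * (Q + 1)\<^sup>2"
    unfolding e by simp
  also have "\<dots> = a * (Suc Q + 1)\<^sup>2"
    unfolding assms by (simp add: power2_eq_square algebra_simps)
  finally show ?case .
qed

end

text \<open>Completing the square: adding \<open>2 b\<close> to \<open>m\<close> raises
  \<open>m div 2\<close> by \<open>b\<close>, and both sides grow by the same amount, so
  \<open>t\<close> can be inherited from \<open>m mod (2 * b)\<close>. There it is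
  \<open>b - 2 (m div 2) - 2\<close>, odd because \<open>b\<close> is. The bound on \<open>t\<close>
  leaves finitely many curves; its oddness excludes singular ones.\<close>

lemma partition_count_12a_diff_squares:
  fixes b m :: nat
  assumes "odd b" "b \<ge> 3"
  shows "\<exists>t::int. odd t \<and> \<bar>t\<bar> \<le> b \<and>
    8 * int b * int (partition_count {1, 2, 2 * b} m) + t\<^sup>2 = (2 * int (m div 2) + 2 + int b)\<^sup>2"
proof (induction m rule: less_induct)
  case (less m)
  show ?case
  proof (cases "m < 2 * b")
    case True
    then have "8 * int b * int (partition_count {1, 2, 2 * b} m) + (int b - 2 * int (m div 2) - 2)\<^sup>2
        = (2 * int (m div 2) + 2 + int b)\<^sup>2"
      using assms by (subst partition_count_12a_less) (auto simp: power2_eq_square algebra_simps)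
    moreover have "m div 2 < b" using True by simp
    then have "\<bar>int b - 2 * int (m div 2) - 2\<bar> \<le> b" by linarith
    moreover have "odd (int b - 2 * int (m div 2) - 2)" using assms by simp
    ultimately show ?thesis by blast
  next
    case False
    define k where "k = m - 2 * b"
    have m: "m = k + 2 * b" using False by (simp add: k_def)
    obtain t :: int where t: "odd t" "\<bar>t\<bar> \<le> b"
      "8 * int b * int (partition_count {1, 2, 2 * b} k) + t\<^sup>2 = (2 * int (k div 2) + 2 + int b)\<^sup>2"
      using less[of k] m assms by auto
    have "partition_count {1, 2, 2 * b} m = k div 2 + b + 1 + partition_count {1, 2, 2 * b} k"
      unfolding m using assms by (subst partition_count_12a_add) auto
    moreover have "m div 2 = k div 2 + b" using m by simp
    ultimately have
      "8 * int b * int (partition_count {1, 2, 2 * b} m) + t\<^sup>2 = (2 * int (m div 2) + 2 + int b)\<^sup>2"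
      using t(3) by (simp add: power2_eq_square algebra_simps)
    then show ?thesis using t by blast
  qed
qed

section \<open>Closed formulas for the parts up to 3 and up to 4\<close>

lemma partition_count_123_add: "partition_count {1, 2, 3} (n + 3) = (n + 3) div 2 + 1 + partition_count {1, 2, 3} n"
  by (rule partition_count_12a_add) simp

lemma partition_count_123:
  "12 * int (partition_count {1, 2, 3} n) = (int n + 3)\<^sup>2 + [3, -4, -1, 0, -1, -4] ! (n mod 6)"
proof (induction n rule: less_induct)
  case (less n)
  show ?case
  proof (cases "n < 6")
    case True
    then have "n = 0 \<or> n = 1 \<or> n = 2 \<or> n = 0 + 3 \<or> n = 1 + 3 \<or> n = 2 + 3" by auto
    moreover have "partition_count {1, 2, 3} 0 = 1" "partition_count {1, 2, 3} 1 = 1"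
        "partition_count {1, 2, 3} 2 = 2"
      by (simp_all add: partition_count_12a_less del: One_nat_def)
    ultimately show ?thesis
      using partition_count_123_add[of 0] partition_count_123_add[of 1] partition_count_123_add[of 2]
      by (elim disjE) simp_all
  next
    case False
    define k where "k = n - 6"
    have n: "n = k + 3 + 3" using False by (simp add: k_def)
    have "(k + 3 + 3) div 2 + (k + 3) div 2 = k + 4" by presburger
    then have "partition_count {1, 2, 3} n = k + 6 + partition_count {1, 2, 3} k"
      unfolding n partition_count_123_add by simp
    moreover have "n mod 6 = k mod 6" unfolding n by simp
    ultimately show ?thesis using less[of k] n by (simp add: power2_eq_square algebra_simps)
  qed
qed

lemma partition_count_upto_4_less:
  "n < 4 \<Longrightarrow> partition_count_upto 4 n = partition_count {1, 2, 3} n"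
  and partition_count_upto_4_add:
  "partition_count_upto 4 (n + 4) = partition_count {1, 2, 3} (n + 4) + partition_count_upto 4 n"
proof -
  have "{1..4} = insert (4::nat) {1, 2, 3}" by auto
  then show "n < 4 \<Longrightarrow> partition_count_upto 4 n = partition_count {1, 2, 3} n"
    "partition_count_upto 4 (n + 4) = partition_count {1, 2, 3} (n + 4) + partition_count_upto 4 n"
    using partition_count_insert_less[of "{1,2,3}" 4 n] partition_count_insert_add[of "{1,2,3}" 4 n]
    by (simp_all add: partition_count_upto_def)
qed

text \<open>The factor 144 is \<open>3! * 4!\<close>, the inverse of the leading coefficient, and
  the shift 5 is half of \<open>1 + 2 + 3 + 4\<close>, which removes the quadratic term. The
  induction runs through one period 12, the least common multiple of the parts, by three uses of the
  recursion for the part 4.\<close>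

lemma partition_count_upto_4:
  "144 * int (partition_count_upto 4 n) =
    (int n + 5) ^ 3 - (if even n then 3 else 12) * (int n + 5)
    + [34, 0, -34, 16, 18, -16, -2, 0, 2, 16, -18, -16] ! (n mod 12)"
proof (induction n rule: less_induct)
  case (less n)
  show ?case
  proof (cases "n < 12")
    case True
    have small: "144 * int (partition_count_upto 4 n) = 12 * ((int n + 3)\<^sup>2 + [3, -4, -1, 0, -1, -4] ! (n mod 6))"
      if "n < 4" for n
      using partition_count_123[of n] partition_count_upto_4_less[OF that] by simp
    have step: "144 * int (partition_count_upto 4 (n + 4)) =
        12 * ((int n + 7)\<^sup>2 + [3, -4, -1, 0, -1, -4] ! ((n + 4) mod 6)) + 144 * int (partition_count_upto 4 n)" for n
      using partition_count_123[of "n + 4"] partition_count_upto_4_add[of n] by (simp add: add_ac)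
    from True have "n \<in> set [0..<12]" by simp
    then have "n \<in> set [0, 1, 2, 3, 4, 5, 6, 7, 8, 9, 10, 11]" by (simp add: upt_rec numeral_eq_Suc)
    moreover note small[of 0] small[of 1] small[of 2] small[of 3]
      step[of 0] step[of 1] step[of 2] step[of 3] step[of 4] step[of 5] step[of 6] step[of 7]
    ultimately show ?thesis by auto
  next
    case False
    define k where "k = n - 12"
    have n: "n = k + 4 + 4 + 4" using False by (simp add: k_def)
    have P: "144 * int (partition_count_upto 4 n) = 144 * int (partition_count_upto 4 k) +
        12 * (12 * int (partition_count {1, 2, 3} (k + 4)) + 12 * int (partition_count {1, 2, 3} (k + 4 + 4))
          + 12 * int (partition_count {1, 2, 3} (k + 4 + 4 + 4)))"
      unfolding n partition_count_upto_4_add by simp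
    have "k mod 6 < 6" by simp
    then have "k mod 6 \<in> {0,1,2,3,4,5}" by auto
    moreover have "(k + 4) mod 6 = (k mod 6 + 4) mod 6" "(k + 4 + 4) mod 6 = (k mod 6 + 8) mod 6"
      "(k + 4 + 4 + 4) mod 6 = k mod 6" "even k = even (k mod 6)" by presburger+
    ultimately have d: "[3, -4, -1, 0, -1, -4] ! ((k + 4) mod 6) + [3, -4, -1, 0, -1, -4] ! ((k + 4 + 4) mod 6)
       + [3, -4, -1, 0, -1, -4] ! ((k + 4 + 4 + 4) mod 6) = (if even k then 1 else -8 :: int)"
      by auto
    have "144 * int (partition_count_upto 4 n) = 144 * int (partition_count_upto 4 k) +
        12 * ((int k + 7)\<^sup>2 + (int k + 11)\<^sup>2 + (int k + 15)\<^sup>2 + (if even k then 1 else -8))"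
      unfolding P partition_count_123 d[symmetric] by (simp add: add_ac)
    also have "144 * int (partition_count_upto 4 k) = (int k + 5) ^ 3 - (if even k then 3 else 12) * (int k + 5)
        + [34, 0, -34, 16, 18, -16, -2, 0, 2, 16, -18, -16] ! (k mod 12)"
      using less[of k] n by simp
    finally have "144 * int (partition_count_upto 4 n) =
        (int k + 5) ^ 3 - (if even k then 3 else 12) * (int k + 5)
        + [34, 0, -34, 16, 18, -16, -2, 0, 2, 16, -18, -16] ! (k mod 12) +
        12 * ((int k + 7)\<^sup>2 + (int k + 11)\<^sup>2 + (int k + 15)\<^sup>2 + (if even k then 1 else -8))" .
    moreover have "n mod 12 = k mod 12" "even n = even k" "int n = int k + 12" unfolding n by simp_all
    moreover have "(int k + 5) ^ 3 - (if even k then 3 else 12) * (int k + 5) +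
        12 * ((int k + 7)\<^sup>2 + (int k + 11)\<^sup>2 + (int k + 15)\<^sup>2 + (if even k then 1 else -8))
        = (int k + 12 + 5) ^ 3 - (if even k then 3 else 12) * (int k + 12 + 5)"
      by (simp add: power2_eq_square power3_eq_cube algebra_simps)
    ultimately show ?thesis by simp
  qed
qed

text \<open>Of the periodic constant only a bound and 2-adic information are kept: the coefficient 3
  comes with \<open>c mod 4 = 2\<close>, and for odd \<open>n\<close> the coefficient 12 comes with
  \<open>16 dvd c\<close>. This pairing is the input of the nonsingularity argument.\<close>

lemma partition_count_upto_4_even:
  assumes "even n"
  shows "\<exists>c::int. \<bar>c\<bar> \<le> 34 \<and> c mod 4 = 2 \<and>
    144 * int (partition_count_upto 4 n) = (int n + 5) ^ 3 - 3 * (int n + 5) + c"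
proof -
  obtain k where "n = 2 * k" using assms by (elim evenE)
  moreover have "k mod 6 < 6" by simp
  then have "k mod 6 = 0 \<or> k mod 6 = 1 \<or> k mod 6 = 2 \<or> k mod 6 = 3 \<or> k mod 6 = 4 \<or> k mod 6 = 5"
    by linarith
  moreover have "(2 * k) mod 12 = 2 * (k mod 6)" using mod_mult2_eq[of "2 * k" 2 6] by simp
  ultimately have "n mod 12 \<in> {0,2,4,6,8,10}" by auto
  then show ?thesis using partition_count_upto_4[of n] assms by auto
qed

lemma partition_count_upto_4_odd:
  assumes "odd n"
  shows "\<exists>c::int. \<bar>c\<bar> \<le> 34 \<and> 16 dvd c \<and>
    144 * int (partition_count_upto 4 n) = (int n + 5) ^ 3 - 12 * (int n + 5) + c"
proof -
  obtain k where "n = 2 * k + 1" using assms by (elim oddE)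
  moreover have "k mod 6 < 6" by simp
  then have "k mod 6 = 0 \<or> k mod 6 = 1 \<or> k mod 6 = 2 \<or> k mod 6 = 3 \<or> k mod 6 = 4 \<or> k mod 6 = 5"
    by linarith
  moreover have "(2 * k + 1) mod 12 = 2 * (k mod 6) + 1" using mod_mult2_eq[of "2 * k + 1" 2 6] by simp
  ultimately have "n mod 12 \<in> {1,3,5,7,9,11}" by auto
  then show ?thesis using partition_count_upto_4[of n] assms by auto
qed

section \<open>The parametric family of solutions\<close>

lemma infinitely_many_solutions:
  assumes "a \<ge> 3" "\<not> [a = 2] (mod 4)"
  shows "infinite {(m :: nat, n :: nat). m > 0 \<and> n > 0 \<and>
              partition_count {1, 2, a} m = partition_count_upto 4 n}" (is "infinite ?S")
proof -
  \<comment> \<open>This solves \<open>r div 2 + (r + a) div 2 + 2 = a\<close>. For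
    \<open>a = 2 b\<close> with \<open>b\<close> odd that equation would read
    \<open>2 * (r div 2) = b - 2\<close>, which is impossible.\<close>
  define r where "r = (if odd a then (a - 3) div 2 else a div 2 - 2)"
  have mod: "a mod 4 \<noteq> 2" using assms(2) by (simp add: cong_def)
  have r: "r < a" "r div 2 + (r + a) div 2 + 2 = a"
  proof -
    show "r < a" using assms(1) by (auto simp: r_def)
    show "r div 2 + (r + a) div 2 + 2 = a"
    proof (cases "odd a")
      case True
      define k where "k = (a - 3) div 2"
      have "r = k" "a = 2 * k + 3" using True assms(1) by (simp_all add: r_def k_def)
      then show ?thesis by presburger
    next
      case False
      have "a mod 4 = 0" using False mod by presburger
      then obtain k where "a = 4 * k" by (metis mod_0_imp_dvd dvdE)
      then have "r = 2 * k - 2" "a = 4 * k" "k > 0" using assms(1) by (auto simp: r_def)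
      then show ?thesis by presburger
    qed
  qed
  \<comment> \<open>For \<open>X = n + 5\<close> with \<open>n mod 12 = 3\<close> we have \<open>144 P\<^sub>4(n) = (X - 2)^2 (X + 4)\<close>, so \<open>X + 4\<close> is
    taken to be \<open>a\<close> times a square.\<close>
  define n where "n w = 144 * a * w\<^sup>2 - 9" for w :: nat
  \<comment> \<open>With \<open>X + 4 = 144 a w^2\<close> the cubic gives
    \<open>P_4(n) = a (w (X - 2))^2\<close>, so \<open>Q + 1\<close> has to be
    \<open>w (X - 2)\<close>. The factor 144 also puts \<open>n w\<close> into the class 3 modulo
    12.\<close>
  define Q where "Q w = w * (144 * a * w\<^sup>2 - 6) - 1" for w :: nat
  define m where "m w = 2 * a * Q w + a + r" for w
  have sol: "(m w, n w) \<in> ?S" if "w > 0" for w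
  proof -
    have aw: "a * w\<^sup>2 \<ge> 3" using assms(1) that
      by (metis mult_le_mono nat_mult_1_right one_le_power Suc_leI One_nat_def)
    define z where "z = a * w\<^sup>2"
    have nz: "n w = 144 * z - 9" and z: "z \<ge> 3" using aw by (simp_all add: n_def z_def mult.assoc)
    have Qz: "Q w + 1 = w * (144 * z - 6)" using z that by (simp add: Q_def z_def mult.assoc)
    have nm: "n w mod 12 = 3" 
  proof -
    have "n w = 3 + 12 * (12 * (z - 1) + 11)" using z by (simp add: nz)
    then show ?thesis by (simp only: mod_mult_self2) simp
  qed
    have "odd (n w)" using z by (simp add: nz)
    then have "144 * int (partition_count_upto 4 (n w)) = (int (n w) + 5) ^ 3 - 12 * (int (n w) + 5) + 16"
      using partition_count_upto_4[of "n w"] nm by simp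
    also have "int (n w) + 5 = 144 * int z - 4" using z by (simp add: nz)
    also have "(144 * int z - 4) ^ 3 - 12 * (144 * int z - 4) + 16 = 144 * (int z * (144 * int z - 6)\<^sup>2)"
      by (simp add: power2_eq_square power3_eq_cube algebra_simps)
    finally have "int (partition_count_upto 4 (n w)) = int z * (144 * int z - 6)\<^sup>2" by simp
    also have "\<dots> = int (z * (144 * z - 6)\<^sup>2)" using z by (simp add: of_nat_diff)
    finally have "partition_count_upto 4 (n w) = z * (144 * z - 6)\<^sup>2" by linarith
    moreover have "partition_count {1, 2, a} (m w) = a * (w * (144 * z - 6))\<^sup>2"
      unfolding m_def partition_count_12a_square[OF assms(1) r] Qz ..
    ultimately have "partition_count {1, 2, a} (m w) = partition_count_upto 4 (n w)"
      by (simp add: z_def power_mult_distrib)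
    moreover have "m w > 0" "n w > 0" using assms(1) z by (auto simp: m_def nz)
    ultimately show ?thesis by simp
  qed
  have "infinite (n ` {1..})"
  proof (rule infinite_super)
    have "inj (\<lambda>k. n (Suc k))"
    proof (rule inj_onI)
      fix x y assume "n (Suc x) = n (Suc y)"
      moreover have "144 * a * (Suc k)\<^sup>2 \<ge> 9" for k
        using assms(1) mult_le_mono[of 9 "144 * a" 1 "(Suc k)\<^sup>2"] by simp
      ultimately have "144 * a * (Suc x)\<^sup>2 = 144 * a * (Suc y)\<^sup>2"
        unfolding n_def by (metis eq_diff_iff)
      then show "x = y" using assms(1) by simp
    qed
    then show "infinite (range (\<lambda>k. n (Suc k)))"
      using finite_imageD infinite_UNIV_nat by blast
    show "range (\<lambda>k. n (Suc k)) \<subseteq> n ` {1..}" by auto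
  qed
  moreover have "n ` {1..} \<subseteq> snd ` ?S"
  proof
    fix y assume "y \<in> n ` {1..}"
    then obtain w where "w \<in> {1..}" "y = n w" by blast
    then have "w > 0" "y = n w" by auto
    then show "y \<in> snd ` ?S" using sol[of w] by (intro image_eqI[of _ _ "(m w, n w)"]) auto
  qed
  ultimately show ?thesis by (meson finite_imageI finite_subset)
qed

section \<open>Thue's approximation theorem\<close>

abbreviation real_poly :: "int poly \<Rightarrow> real poly" where
  "real_poly \<equiv> map_poly of_int"

lemma real_poly_eq_0_iff [simp]: "real_poly p = 0 \<longleftrightarrow> p = 0"
  by (rule map_poly_eq_0_iff) auto

lemma degree_real_poly [simp]: "degree (real_poly p) = degree p"
  by (rule degree_map_poly) simp

lemma coeff_real_poly [simp]: "coeff (real_poly p) i = of_int (coeff p i)"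
  by (simp add: coeff_map_poly)

lemma real_poly_diff: "real_poly (p - q) = real_poly p - real_poly q"
  by (intro poly_eqI) simp

lemma real_poly_add: "real_poly (p + q) = real_poly p + real_poly q"
  by (intro poly_eqI) simp

lemma real_poly_mult: "real_poly (p * q) = real_poly p * real_poly q"
  by (intro poly_eqI) (simp add: coeff_mult)

lemma real_poly_smult: "real_poly (smult c p) = smult (of_int c) (real_poly p)"
  by (intro poly_eqI) simp

lemma real_poly_pderiv: "real_poly (pderiv p) = pderiv (real_poly p)"
  by (intro poly_eqI) (simp add: coeff_pderiv)

text \<open>Pigeonhole: the box of vectors with entries in \<open>{0..H}\<close> has more points
  than the box containing its image under \<open>A\<close>, and the difference of two points with
  equal image has entries between \<open>-H\<close> and \<open>H\<close>.\<close>

lemma siegel_lemma: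
  fixes A :: "'e \<Rightarrow> 'i \<Rightarrow> int" and B H :: nat
  assumes "finite S" "finite I"
    and A: "\<And>e i. e \<in> S \<Longrightarrow> i \<in> I \<Longrightarrow> \<bar>A e i\<bar> \<le> int B"
    and card: "(2 * card I * B * H + 1) ^ card S < (H + 1) ^ card I"
  obtains x :: "'i \<Rightarrow> int" where "\<exists>i\<in>I. x i \<noteq> 0" "\<And>i. i \<in> I \<Longrightarrow> \<bar>x i\<bar> \<le> int H"
    "\<And>e. e \<in> S \<Longrightarrow> (\<Sum>i\<in>I. A e i * x i) = 0"
proof -
  define X where "X = (\<Pi>\<^sub>E i\<in>I. {0..int H})"
  define b where "b = int (card I * B * H)"
  define Y where "Y = (\<Pi>\<^sub>E e\<in>S. {- b..b})"
  define L where "L x = (\<lambda>e\<in>S. \<Sum>i\<in>I. A e i * x i)" for x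
  have "L ` X \<subseteq> Y"
  proof
    fix y assume "y \<in> L ` X"
    then obtain x where x: "x \<in> X" "y = L x" by auto
    have "\<bar>\<Sum>i\<in>I. A e i * x i\<bar> \<le> b" if "e \<in> S" for e
    proof -
      have "\<bar>A e i * x i\<bar> \<le> int (B * H)" if "i \<in> I" for i
      proof -
        have "\<bar>x i\<bar> \<le> int H" using PiE_mem[OF x(1)[unfolded X_def] that] by simp
        then show ?thesis using mult_mono[OF A[OF \<open>e \<in> S\<close> that]] by (simp add: abs_mult)
      qed
      then have "(\<Sum>i\<in>I. \<bar>A e i * x i\<bar>) \<le> of_nat (card I) * int (B * H)"
        by (rule sum_bounded_above)
      then show ?thesis by (intro order_trans[OF sum_abs]) (simp add: b_def mult.assoc)
    qed
    then show "y \<in> Y" using x(2) by (force simp: Y_def L_def abs_le_iff)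
  qed
  moreover have finY: "finite Y" using assms(1) by (simp add: Y_def finite_PiE)
  ultimately have "card (L ` X) \<le> card Y" by (rule card_mono[rotated])
  also have "card Y = (2 * card I * B * H + 1) ^ card S"
  proof -
    have "nat (2 * b + 1) = 2 * card I * B * H + 1" by (simp add: b_def nat_eq_iff)
    then show ?thesis using assms(1) by (simp add: Y_def card_PiE)
  qed
  also have "\<dots> < card X"
  proof -
    have "nat (int H + 1) = H + 1" by simp
    then show ?thesis using card assms(2) by (simp add: X_def card_PiE)
  qed
  finally have "\<not> inj_on L X" by (rule pigeonhole)
  then obtain x y where xy: "x \<in> X" "y \<in> X" "x \<noteq> y" "L x = L y" by (auto simp: inj_on_def)
  show thesis
  proof
    show "\<exists>i\<in>I. x i - y i \<noteq> 0"
      using xy(1-3) unfolding X_def by (metis PiE_ext eq_iff_diff_eq_0)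
    show "\<bar>x i - y i\<bar> \<le> int H" if "i \<in> I" for i
    proof -
      have "x i \<in> {0..int H}" "y i \<in> {0..int H}" using xy(1,2) that by (auto simp: X_def)
      then show ?thesis by auto
    qed
    show "(\<Sum>i\<in>I. A e i * (x i - y i)) = 0" if "e \<in> S" for e
      using fun_cong[OF xy(4), of e] that by (simp add: L_def right_diff_distrib sum_subtractf)
  qed
qed

section \<open>Taylor coefficients\<close>

text \<open>Divided derivatives \<open>p^(j)(x) / j!\<close>: they bring in binomial coefficients
  instead of factorials, which keeps all bounds exponential in the degree.\<close>

definition taylor_coeff :: "'a::comm_ring_1 \<Rightarrow> 'a poly \<Rightarrow> nat \<Rightarrow> 'a" where
  "taylor_coeff x p = coeff (pcompose p [:x, 1:])"

lemma pcompose_monom: "pcompose (monom c n) q = smult c (q ^ n)"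
proof -
  have "pcompose ([:0, 1:] ^ n) q = q ^ n"
    by (induction n) (simp_all add: pcompose_mult pcompose_1 pcompose_pCons)
  then show ?thesis by (simp add: monom_altdef pcompose_smult)
qed

lemma taylor_coeff_eq:
  assumes "degree p < n"
  shows "taylor_coeff x p j = (\<Sum>i<n. coeff p i * of_nat (i choose j) * x ^ (i - j))"
proof -
  have "p = (\<Sum>i\<le>n - 1. monom (coeff p i) i)"
    using poly_as_sum_of_monoms'[of p "n - 1"] assms by simp
  also have "{..n - 1} = {..<n}" using assms by auto
  finally have "pcompose p [:x, 1:] = (\<Sum>i<n. smult (coeff p i) ([:x, 1:] ^ i))"
    by (metis (no_types, lifting) pcompose_monom pcompose_sum sum.cong)
  moreover have "coeff ([:x, 1:] ^ i) j = of_nat (i choose j) * x ^ (i - j)" for i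
  proof (cases "j \<le> i")
    case True
    then show ?thesis by (simp add: coeff_linear_poly_power)
  next
    case False
    then show ?thesis by (simp add: binomial_eq_0 coeff_eq_0 degree_linear_power)
  qed
  ultimately show ?thesis by (simp add: taylor_coeff_def coeff_sum mult.assoc)
qed

lemma linear_power_dvd_if_taylor_coeff_0:
  assumes "\<And>j. j < k \<Longrightarrow> taylor_coeff x p j = 0"
  shows "[:- x, 1:] ^ k dvd p"
proof -
  have "monom 1 k dvd pcompose p [:x, 1:]"
    using assms by (simp add: monom_1_dvd_iff' taylor_coeff_def)
  then obtain r where r: "pcompose p [:x, 1:] = monom 1 k * r" by (elim dvdE)
  have "p = pcompose (pcompose p [:x, 1:]) [:- x, 1:]"
    by (simp add: pcompose_assoc[symmetric] pcompose_pCons)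
  also have "\<dots> = [:- x, 1:] ^ k * pcompose r [:- x, 1:]"
    by (simp add: r pcompose_mult pcompose_monom)
  finally show ?thesis by (metis dvd_triv_left)
qed

lemma taylor_coeff_pcompose:
  "taylor_coeff (x - a) (pcompose p [:a, 1:]) j = taylor_coeff x p j"
  by (simp add: taylor_coeff_def pcompose_assoc[symmetric] pcompose_pCons)

lemma abs_sum_lessThan_le:
  fixes g :: "nat \<Rightarrow> real"
  assumes "\<And>i. i < n \<Longrightarrow> \<bar>g i\<bar> \<le> K"
  shows "\<bar>\<Sum>i<n. g i\<bar> \<le> of_nat n * K"
proof -
  have "\<bar>\<Sum>i<n. g i\<bar> \<le> (\<Sum>i<n. \<bar>g i\<bar>)" by (rule sum_abs)
  also have "\<dots> \<le> of_nat (card {..<n}) * K" by (rule sum_bounded_above) (use assms in auto)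
  finally show ?thesis by simp
qed

lemma binomial_le_power_2: "i < n \<Longrightarrow> real (i choose j) \<le> 2 ^ n"
proof -
  assume "i < n"
  have "i choose j \<le> 2 ^ i"
    by (cases "j \<le> i") (simp_all add: binomial_le_pow2 binomial_eq_0)
  also have "\<dots> \<le> 2 ^ n" using \<open>i < n\<close> by (intro power_increasing) auto
  finally show ?thesis by (metis of_nat_le_iff of_nat_numeral of_nat_power)
qed

lemma taylor_coeff_bound:
  fixes x :: real
  assumes "degree p < n" and M: "\<And>i. \<bar>coeff p i\<bar> \<le> M"
  shows "\<bar>taylor_coeff x p j\<bar> \<le> n * (M * 2 ^ n * (1 + \<bar>x\<bar>) ^ n)"
  unfolding taylor_coeff_eq[OF assms(1)]
proof (rule abs_sum_lessThan_le)
  fix i assume i: "i < n"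
  have "\<bar>x\<bar> ^ (i - j) \<le> (1 + \<bar>x\<bar>) ^ (i - j)" by (intro power_mono) auto
  also have "\<dots> \<le> (1 + \<bar>x\<bar>) ^ n" using i by (intro power_increasing) auto
  finally have "\<bar>x\<bar> ^ (i - j) \<le> (1 + \<bar>x\<bar>) ^ n" .
  moreover have "0 \<le> M" using M[of 0] by linarith
  ultimately show "\<bar>coeff p i * real (i choose j) * x ^ (i - j)\<bar> \<le> M * 2 ^ n * (1 + \<bar>x\<bar>) ^ n"
    unfolding abs_mult power_abs using M[of i] binomial_le_power_2[OF i, of j]
    by (intro mult_mono) auto
qed

text \<open>In the expansion around \<open>a\<close> only terms of index at least \<open>N\<close>
  survive, and each contributes a power of \<open>x - a\<close> with exponent at least
  \<open>N - j\<close>. For \<open>j \<ge> N\<close> the truncated exponent 0 is still correct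
  because \<open>\<bar>x - a\<bar> \<le> 1\<close>.\<close>

lemma taylor_coeff_bound_near_zero:
  fixes x a :: real
  assumes "degree p < n" and M: "\<And>i. \<bar>taylor_coeff a p i\<bar> \<le> M"
    and zero: "\<And>i. i < N \<Longrightarrow> taylor_coeff a p i = 0" and "\<bar>x - a\<bar> \<le> 1"
  shows "\<bar>taylor_coeff x p j\<bar> \<le> n * (M * 2 ^ n * \<bar>x - a\<bar> ^ (N - j))"
proof -
  have "degree (pcompose p [:a, 1:]) < n" using assms(1) by (simp add: degree_pcompose)
  from taylor_coeff_eq[OF this, of "x - a" j]
  have "taylor_coeff x p j = (\<Sum>i<n. taylor_coeff a p i * real (i choose j) * (x - a) ^ (i - j))"
    by (simp add: taylor_coeff_pcompose) (simp add: taylor_coeff_def)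
  also have "\<bar>\<dots>\<bar> \<le> n * (M * 2 ^ n * \<bar>x - a\<bar> ^ (N - j))"
  proof (rule abs_sum_lessThan_le)
    fix i assume i: "i < n"
    have M0: "0 \<le> M" using M[of 0] by linarith
    show "\<bar>taylor_coeff a p i * real (i choose j) * (x - a) ^ (i - j)\<bar>
        \<le> M * 2 ^ n * \<bar>x - a\<bar> ^ (N - j)"
    proof (cases "i < N")
      case True
      then show ?thesis using zero M0 by simp
    next
      case False
      then have "\<bar>x - a\<bar> ^ (i - j) \<le> \<bar>x - a\<bar> ^ (N - j)"
        using assms(4) by (intro power_decreasing) auto
      then show ?thesis
        unfolding abs_mult power_abs using M[of i] M0 binomial_le_power_2[OF i, of j]
        by (intro mult_mono) auto
    qed
  qed
  finally show ?thesis .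
qed

lemma taylor_coeff_integral:
  assumes "degree p < n" "q > 0"
  shows "\<exists>z::int. taylor_coeff (of_int a / of_nat q) (real_poly p) j * of_nat q ^ n = of_int z"
proof
  have "taylor_coeff (of_int a / of_nat q) (real_poly p) j * of_nat q ^ n =
    (\<Sum>i<n. of_int (coeff p i * int (i choose j) * (a ^ (i - j) * int q ^ (n - (i - j)))))"
    unfolding taylor_coeff_eq[of "real_poly p" n, simplified, OF assms(1)] sum_distrib_right
  proof (rule sum.cong)
    fix i assume "i \<in> {..<n}"
    then have "real q ^ n = real q ^ (i - j) * real q ^ (n - (i - j))"
      by (subst power_add[symmetric]) auto
    then have "(of_int a / real q) ^ (i - j) * real q ^ n = of_int (a ^ (i - j) * int q ^ (n - (i - j)))"
      using assms(2) by (simp add: power_divide)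
    then show "real_of_int (coeff p i) * real (i choose j) * (real_of_int a / real q) ^ (i - j) * real q ^ n =
         real_of_int (coeff p i * int (i choose j) * (a ^ (i - j) * int q ^ (n - (i - j))))"
      by (simp only: mult.assoc of_int_mult of_int_of_nat_eq)
  qed simp
  then show "taylor_coeff (of_int a / of_nat q) (real_poly p) j * of_nat q ^ n =
    of_int (\<Sum>i<n. coeff p i * int (i choose j) * (a ^ (i - j) * int q ^ (n - (i - j))))"
    by simp
qed

section \<open>The auxiliary polynomials\<close>

text \<open>The leading coefficient times \<open>\<alpha>\<close> acts by multiplication on the span
  of \<open>1, ..., \<alpha>^(d-1)\<close> through an integer matrix. A row of it has at most two
  nonzero entries, whose absolute values sum to at most \<open>G\<close>.\<close>

lemma algebraic_power_coords:
  fixes f :: "int poly" and \<alpha> :: real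
  assumes root: "poly (real_poly f) \<alpha> = 0" and deg: "degree f > 0"
  defines "G \<equiv> 1 + \<bar>lead_coeff f\<bar> + (\<Sum>i\<le>degree f. \<bar>coeff f i\<bar>)"
  shows "\<exists>c :: nat \<Rightarrow> int. (\<forall>t. \<bar>c t\<bar> \<le> G ^ m) \<and>
    of_int (lead_coeff f) ^ m * \<alpha> ^ m = (\<Sum>t<degree f. of_int (c t) * \<alpha> ^ t)"
proof (induction m)
  case 0
  have "(\<Sum>t<degree f. of_int (if t = 0 then 1 else 0) * \<alpha> ^ t) = (\<Sum>t<degree f. if t = 0 then 1 else 0)"
    by (intro sum.cong) auto
  then show ?case using deg by (intro exI[of _ "\<lambda>t. if t = 0 then 1 else 0"]) auto
next
  case (Suc m)
  then obtain c where c: "\<And>t. \<bar>c t\<bar> \<le> G ^ m"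
    "of_int (lead_coeff f) ^ m * \<alpha> ^ m = (\<Sum>t<degree f. of_int (c t) * \<alpha> ^ t)" by blast
  obtain e where e: "degree f = Suc e" using deg by (metis gr0_implies_Suc)
  define c' where "c' t = (if t = 0 then 0 else lead_coeff f * c (t - 1)) - c e * coeff f t" for t
  have f_le: "\<bar>coeff f t\<bar> \<le> (\<Sum>i\<le>degree f. \<bar>coeff f i\<bar>)" for t
  proof (cases "t \<le> degree f")
    case True
    then show ?thesis using member_le_sum[of t "{..degree f}" "\<lambda>i. \<bar>coeff f i\<bar>"] by simp
  next
    case False
    then show ?thesis by (simp add: coeff_eq_0 sum_nonneg)
  qed
  have "\<bar>c' t\<bar> \<le> G ^ Suc m" for t
  proof -
    have "\<bar>c' t\<bar> \<le> \<bar>lead_coeff f\<bar> * \<bar>c (t - 1)\<bar> + \<bar>c e\<bar> * \<bar>coeff f t\<bar>"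
      unfolding c'_def abs_mult[symmetric] by auto
    also have "\<dots> \<le> \<bar>lead_coeff f\<bar> * G ^ m + G ^ m * \<bar>coeff f t\<bar>"
      by (intro add_mono mult_left_mono mult_right_mono c) auto
    also have "\<dots> = (\<bar>lead_coeff f\<bar> + \<bar>coeff f t\<bar>) * G ^ m" by (simp add: algebra_simps)
    also have "\<dots> \<le> G * G ^ m"
      using f_le[of t] c(1)[of 0] by (intro mult_right_mono) (auto simp: G_def)
    finally show ?thesis by simp
  qed
  moreover have "of_int (lead_coeff f) ^ Suc m * \<alpha> ^ Suc m = (\<Sum>t<degree f. of_int (c' t) * \<alpha> ^ t)"
  proof -
    have root': "(\<Sum>t<Suc e. of_int (coeff f t) * \<alpha> ^ t) = - of_int (lead_coeff f) * \<alpha> ^ Suc e"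
      using root by (simp add: poly_altdef e lessThan_Suc_atMost)
    have "(\<Sum>t<Suc e. of_int (c' t) * \<alpha> ^ t) =
      (\<Sum>t<Suc e. of_int (if t = 0 then 0 else lead_coeff f * c (t - 1)) * \<alpha> ^ t)
        - of_int (c e) * (\<Sum>t<Suc e. of_int (coeff f t) * \<alpha> ^ t)"
      by (simp add: c'_def sum_distrib_left left_diff_distrib sum_subtractf mult.assoc del: sum.lessThan_Suc)
    also have "(\<Sum>t<Suc e. of_int (if t = 0 then 0 else lead_coeff f * c (t - 1)) * \<alpha> ^ t)
      = of_int (lead_coeff f) * \<alpha> * (\<Sum>t<e. of_int (c t) * \<alpha> ^ t)"
      by (subst sum.lessThan_Suc_shift) (simp add: sum_distrib_left mult_ac)
    also have "\<dots> - of_int (c e) * (\<Sum>t<Suc e. of_int (coeff f t) * \<alpha> ^ t)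
      = of_int (lead_coeff f) * \<alpha> * (\<Sum>t<Suc e. of_int (c t) * \<alpha> ^ t)"
      unfolding root' by (simp add: algebra_simps)
    also have "\<dots> = of_int (lead_coeff f) ^ Suc m * \<alpha> ^ Suc m"
      unfolding e[symmetric] c(2)[symmetric] by simp
    finally show ?thesis by (simp add: e)
  qed
  ultimately show ?case by blast
qed

text \<open>A count of parameters: \<open>U\<close> and \<open>V\<close> have \<open>2 E\<close>
  unknown coefficients, the vanishing conditions split over the powers of \<open>\<alpha>\<close>
  into \<open>2 d l k\<close> equations, and \<open>2 k\<close> unknowns are left over. So the
  exponent in Siegel's lemma is \<open>2 d l k / (2 k) = d l\<close>. For \<open>f\<close> of least
  degree, the order \<open>2 l k\<close> is nearly twice what a single integer polynomial of degree
  below \<open>E\<close> can reach.\<close>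

lemma auxiliary_polynomials:
  fixes f :: "int poly" and \<alpha> :: real and k l :: nat
  assumes root: "poly (real_poly f) \<alpha> = 0" and deg: "degree f = d" "d > 0" and "k > 0" "l > 0"
  defines "G \<equiv> 1 + \<bar>lead_coeff f\<bar> + (\<Sum>i\<le>degree f. \<bar>coeff f i\<bar>)"
  defines "E \<equiv> (d * l + 1) * k"
  obtains U V :: "int poly" where "U \<noteq> 0 \<or> V \<noteq> 0" "degree U < E" "degree V < E"
    "\<And>i. \<bar>real_of_int (coeff U i)\<bar> \<le> ((16 * real_of_int G) ^ E) ^ (d * l)"
    "\<And>i. \<bar>real_of_int (coeff V i)\<bar> \<le> ((16 * real_of_int G) ^ E) ^ (d * l)"
    "\<And>j. j < 2 * l * k \<Longrightarrow> taylor_coeff \<alpha> (real_poly U - smult \<alpha> (real_poly V)) j = 0"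
proof -
  define N where "N = 2 * l * k"
  define a where "a = lead_coeff f"
  have E: "E > 0" using assms(4) by (simp add: E_def)
  have G: "G \<ge> 1" "\<bar>a\<bar> \<le> G" by (simp_all add: G_def a_def sum_nonneg)
  have "\<exists>c :: nat \<Rightarrow> int. \<forall>t. \<bar>c t\<bar> \<le> G ^ E \<and> of_int a ^ E * \<alpha> ^ m = (\<Sum>t<d. of_int (c t) * \<alpha> ^ t)"
    if m: "m \<le> E" for m
  proof -
    obtain c where c: "\<And>t. \<bar>c t\<bar> \<le> G ^ m" "of_int a ^ m * \<alpha> ^ m = (\<Sum>t<d. of_int (c t) * \<alpha> ^ t)"
      using algebraic_power_coords[OF root, of m] deg unfolding G_def a_def by auto
    have GE: "G ^ (E - m) * G ^ m = G ^ E" using m by (subst power_add[symmetric]) simp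
    have aE: "real_of_int a ^ E = real_of_int a ^ (E - m) * real_of_int a ^ m"
      using m by (subst power_add[symmetric]) simp
    have "\<bar>a ^ (E - m) * c t\<bar> \<le> G ^ E" for t
      unfolding abs_mult power_abs GE[symmetric]
      using G c(1)[of t] by (intro mult_mono power_mono) auto
    moreover have "of_int a ^ E * \<alpha> ^ m = (\<Sum>t<d. of_int (a ^ (E - m) * c t) * \<alpha> ^ t)"
      unfolding aE mult.assoc c(2) by (simp add: sum_distrib_left mult.assoc)
    ultimately show ?thesis by (intro exI[of _ "\<lambda>t. a ^ (E - m) * c t"]) blast
  qed
  then obtain C :: "nat \<Rightarrow> nat \<Rightarrow> int" where C: "\<And>m t. m \<le> E \<Longrightarrow> \<bar>C m t\<bar> \<le> G ^ E"
    "\<And>m. m \<le> E \<Longrightarrow> of_int a ^ E * \<alpha> ^ m = (\<Sum>t<d. of_int (C m t) * \<alpha> ^ t)"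
    by metis
  \<comment> \<open>The coefficient of \<open>\<alpha>^t\<close> in the \<open>j\<close>-th
    condition, multiplied by \<open>a ^ E\<close> to clear denominators; \<open>False\<close> marks
    coefficients of \<open>U\<close>, \<open>True\<close> those of \<open>V\<close>. For
    \<open>j > i\<close> the difference \<open>i - j\<close> truncates to 0, but the binomial
    coefficient vanishes.\<close>
  define A :: "nat \<times> nat \<Rightarrow> nat \<times> bool \<Rightarrow> int" where
    "A = (\<lambda>(j, t) (i, b). int (i choose j) * (if b then - C (i - j + 1) t else C (i - j) t))"
  define B where "B = 2 ^ E * nat G ^ E"
  define I where "I = {..<E} \<times> (UNIV :: bool set)"
  define S where "S = {..<N} \<times> {..<d}"
  define H where "H = (2 * card I * B) ^ (d * l) - 1"
  have cI: "card I = 2 * E" and cS: "card S = 2 * d * l * k" by (simp_all add: I_def S_def N_def)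
  have "card I * B > 0" using E G(1) by (simp add: cI B_def)
  then have Bpos: "2 * card I * B \<ge> 2" by linarith
  have HS: "H + 1 = (2 * card I * B) ^ (d * l)" using Bpos by (simp add: H_def)
  have "\<exists>x. (\<exists>i\<in>I. x i \<noteq> 0) \<and> (\<forall>i\<in>I. \<bar>x i\<bar> \<le> int H) \<and> (\<forall>e\<in>S. (\<Sum>i\<in>I. A e i * x i) = 0)"
  proof (rule siegel_lemma[of S I A B H])
    show "finite S" "finite I" by (simp_all add: S_def I_def)
    show "\<bar>A e i\<bar> \<le> int B" if "e \<in> S" "i \<in> I" for e i
    proof -
      obtain j t where e: "e = (j, t)" by fastforce
      obtain i' b where i: "i = (i', b)" by fastforce
      have "i' < E" using that(2) by (simp add: i I_def)
      note eq = e i this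
      have "real_of_int (int (i' choose j)) \<le> real_of_int (2 ^ E)"
        using binomial_le_power_2[OF eq(3), of j] by simp
      then have "int (i' choose j) \<le> 2 ^ E" by (simp only: of_int_le_iff)
      moreover have "\<bar>if b then - C (i' - j + 1) t else C (i' - j) t\<bar> \<le> G ^ E"
        using C(1)[of "i' - j + 1" t] C(1)[of "i' - j" t] eq(3) by auto
      ultimately have "int (i' choose j) * \<bar>if b then - C (i' - j + 1) t else C (i' - j) t\<bar> \<le> 2 ^ E * G ^ E"
        by (intro mult_mono) auto
      then show ?thesis using G(1) by (simp add: A_def eq B_def abs_mult)
    qed
    \<comment> \<open>\<open>H\<close> is chosen so that \<open>(2 * card I * B) ^ card S\<close>
      equals \<open>(H + 1) ^ (2 * k)\<close>, and \<open>2 * k\<close> is exactly the surplus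
      \<open>card I - card S\<close>.\<close>
    have "(2 * card I * B * H + 1) ^ card S < (2 * card I * B * (H + 1)) ^ card S"
    proof (rule power_strict_mono)
      show "2 * card I * B * H + 1 < 2 * card I * B * (H + 1)"
        using Bpos unfolding distrib_left by linarith
      show "0 < card S" using assms(4,5) deg by (simp add: cS)
    qed simp
    also have "\<dots> = (2 * card I * B) ^ card S * (H + 1) ^ card S" by (rule power_mult_distrib)
    also have "(2 * card I * B) ^ card S = (H + 1) ^ (2 * k)"
      unfolding HS by (simp add: cS power_mult[symmetric] mult_ac)
    also have "(H + 1) ^ (2 * k) * (H + 1) ^ card S = (H + 1) ^ card I"
      by (simp add: power_add[symmetric] cS cI E_def algebra_simps)
    finally show "(2 * card I * B * H + 1) ^ card S < (H + 1) ^ card I" .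
  qed blast
  then obtain x where x: "\<exists>i\<in>I. x i \<noteq> 0" "\<And>i. i \<in> I \<Longrightarrow> \<bar>x i\<bar> \<le> int H"
    "\<And>e. e \<in> S \<Longrightarrow> (\<Sum>i\<in>I. A e i * x i) = 0" by blast
  define U where "U = (\<Sum>i<E. monom (x (i, False)) i)"
  define V where "V = (\<Sum>i<E. monom (x (i, True)) i)"
  have cU: "coeff U i = (if i < E then x (i, False) else 0)"
    and cV: "coeff V i = (if i < E then x (i, True) else 0)" for i
    by (simp_all add: U_def V_def coeff_sum coeff_monom)
  have dU: "degree U < E" and dV: "degree V < E"
    using E by (auto intro!: degree_lessI simp: cU cV)
  have "real H \<le> ((16 * real_of_int G) ^ E) ^ (d * l)"
  proof -
    have "E \<le> 2 ^ E" using less_exp[of E] by simp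
    moreover have "(4::nat) \<le> 4 ^ E" using E by (cases E) auto
    ultimately have "2 * card I * B \<le> 4 ^ E * 2 ^ E * B"
      unfolding cI by (simp add: mult_le_mono)
    also have "\<dots> = (4 * 2 * (2 * nat G)) ^ E"
      unfolding B_def by (simp only: power_mult_distrib)
    also have "4 * 2 * (2 * nat G) = 16 * nat G" by simp
    finally have "H \<le> ((16 * nat G) ^ E) ^ (d * l)"
      unfolding H_def by (meson diff_le_self order_trans power_mono zero_le)
    then have "real H \<le> real (((16 * nat G) ^ E) ^ (d * l))" by (simp only: of_nat_le_iff)
    then show ?thesis using G(1) by simp
  qed
  then have xH: "\<bar>real_of_int (x i)\<bar> \<le> ((16 * real_of_int G) ^ E) ^ (d * l)" if "i \<in> I" for i
    using x(2)[OF that] by linarith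
  have nn: "0 \<le> ((16 * real_of_int G) ^ E) ^ (d * l)" using G(1) by simp
  show thesis
  proof (rule that)
    obtain i b where "(i, b) \<in> I" "x (i, b) \<noteq> 0" using x(1) by auto
    then have "coeff U i \<noteq> 0 \<or> coeff V i \<noteq> 0" by (cases b) (auto simp: cU cV I_def)
    then show "U \<noteq> 0 \<or> V \<noteq> 0" by auto
    show "degree U < E" "degree V < E" by fact+
    show "\<bar>real_of_int (coeff U i)\<bar> \<le> ((16 * real_of_int G) ^ E) ^ (d * l)"
      "\<bar>real_of_int (coeff V i)\<bar> \<le> ((16 * real_of_int G) ^ E) ^ (d * l)" for i
      using nn xH by (auto simp: cU cV I_def)
    fix j assume "j < 2 * l * k"
    then have j: "j < N" by (simp add: N_def)
    have "degree (real_poly U - smult \<alpha> (real_poly V)) < E"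
      using dU dV by (intro degree_diff_less) auto
    from taylor_coeff_eq[OF this]
    have "of_int a ^ E * taylor_coeff \<alpha> (real_poly U - smult \<alpha> (real_poly V)) j
      = (\<Sum>i<E. of_int a ^ E * ((of_int (x (i, False)) - \<alpha> * of_int (x (i, True))) * real (i choose j) * \<alpha> ^ (i - j)))"
      by (simp add: sum_distrib_left cU cV)
    also have "\<dots> = (\<Sum>i<E. \<Sum>t<d. of_int (A (j, t) (i, False) * x (i, False) + A (j, t) (i, True) * x (i, True)) * \<alpha> ^ t)"
    proof (rule sum.cong)
      fix i assume "i \<in> {..<E}"
      then have i: "i - j \<le> E" "i - j + 1 \<le> E" by auto
      have "of_int a ^ E * ((of_int (x (i, False)) - \<alpha> * of_int (x (i, True))) * real (i choose j) * \<alpha> ^ (i - j))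
        = real (i choose j) * (of_int (x (i, False)) * (of_int a ^ E * \<alpha> ^ (i - j))
           - of_int (x (i, True)) * (of_int a ^ E * \<alpha> ^ (i - j + 1)))"
        by (simp add: algebra_simps)
      also have "\<dots> = (\<Sum>t<d. of_int (A (j, t) (i, False) * x (i, False) + A (j, t) (i, True) * x (i, True)) * \<alpha> ^ t)"
        unfolding C(2)[OF i(1)] C(2)[OF i(2)]
        by (simp add: A_def sum_distrib_left sum_subtractf[symmetric] algebra_simps)
      finally show "of_int a ^ E * ((of_int (x (i, False)) - \<alpha> * of_int (x (i, True))) * real (i choose j) * \<alpha> ^ (i - j)) = \<dots>" .
    qed simp
    also have "\<dots> = (\<Sum>t<d. of_int (\<Sum>i\<in>I. A (j, t) i * x i) * \<alpha> ^ t)"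
    proof -
      have "(\<Sum>i\<in>I. h i) = (\<Sum>i<E. h (i, False) + h (i, True))" for h :: "nat \<times> bool \<Rightarrow> int"
        using sum.cartesian_product[of "\<lambda>i b. h (i, b)" "UNIV :: bool set" "{..<E}"]
        by (simp add: I_def UNIV_bool)
      then show ?thesis by (subst sum.swap) (simp add: sum_distrib_right)
    qed
    also have "\<dots> = 0"
      using x(3) j by (intro sum.neutral) (auto simp: S_def)
    finally show "taylor_coeff \<alpha> (real_poly U - smult \<alpha> (real_poly V)) j = 0"
      using deg by (auto simp: a_def)
  qed
qed

section \<open>Zero estimates\<close>

text \<open>An integer polynomial vanishing at \<open>\<alpha>\<close> is divisible by
  \<open>f\<close> up to a constant. Splitting off \<open>f\<close> costs \<open>degree f\<close> in
  the degree but only one in the order at \<open>\<alpha>\<close>, a simple root by minimality, and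
  nothing in the order at \<open>x\<close>. In other words, all conjugates of
  \<open>\<alpha>\<close> are zeros of the same multiplicity.\<close>

lemma order_add_order_le_degree:
  fixes f p :: "int poly" and \<alpha> x :: real
  assumes "f \<noteq> 0" and root: "poly (real_poly f) \<alpha> = 0"
    and minimal: "\<And>g. g \<noteq> 0 \<Longrightarrow> poly (real_poly g) \<alpha> = 0 \<Longrightarrow> degree f \<le> degree g"
    and x: "poly (real_poly f) x \<noteq> 0" and "p \<noteq> 0"
  shows "order x (real_poly p) + degree f * order \<alpha> (real_poly p) \<le> degree p"
  using \<open>p \<noteq> 0\<close>
proof (induction "degree p" arbitrary: p rule: less_induct)
  case less
  have deg_f: "degree f > 0"
  proof (rule ccontr)
    assume "\<not> degree f > 0"
    then obtain c where "f = [:c:]" by (metis degree_eq_zeroE gr0I)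
    then show False using root \<open>f \<noteq> 0\<close> by (simp add: map_poly_pCons)
  qed
  show ?case
  proof (cases "poly (real_poly p) \<alpha> = 0")
    case False
    then have "order \<alpha> (real_poly p) = 0" by (simp add: order_root)
    then show ?thesis using order_degree[of "real_poly p" x] less.prems by simp
  next
    case True
    obtain q r where qr: "pseudo_divmod p f = (q, r)" by (meson surj_pair)
    define c where "c = coeff f (degree f) ^ (Suc (degree p) - degree f)"
    have c: "c \<noteq> 0" using \<open>f \<noteq> 0\<close> by (simp add: c_def)
    have eq: "smult c p = f * q + r" and r: "r = 0 \<or> degree r < degree f"
      using pseudo_divmod[OF \<open>f \<noteq> 0\<close> qr] by (simp_all add: c_def)
    from arg_cong[OF eq, of real_poly]
    have eq': "smult (of_int c) (real_poly p) = real_poly f * real_poly q + real_poly r"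
      by (simp add: real_poly_add real_poly_mult real_poly_smult)
    from arg_cong[OF this, of "\<lambda>p. poly p \<alpha>"] have "poly (real_poly r) \<alpha> = 0"
      using True root by simp
    then have "r = 0" using r minimal[of r] by (meson linorder_not_less)
    then have eq1: "smult c p = f * q" and eq2: "smult (of_int c) (real_poly p) = real_poly f * real_poly q"
      using eq eq' by simp_all
    have q: "q \<noteq> 0" using eq1 c less.prems by auto
    have deg: "degree p = degree f + degree q"
      using arg_cong[OF eq1, of degree] c q \<open>f \<noteq> 0\<close> by (simp add: degree_mult_eq)
    have ord: "order y (real_poly p) = order y (real_poly f) + order y (real_poly q)" for y
    proof -
      have "order y (real_poly p) = order y (smult (of_int c) (real_poly p))"
        using c by (simp add: order_smult)
      also have "\<dots> = order y (real_poly f) + order y (real_poly q)"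
        unfolding eq2 using q \<open>f \<noteq> 0\<close> by (intro order_mult) simp
      finally show ?thesis .
    qed
    have "order x (real_poly f) = 0" using x by (simp add: order_root)
    moreover have "order \<alpha> (real_poly f) = 1"
    proof -
      have "pderiv f \<noteq> 0" using deg_f by (simp add: pderiv_eq_0_iff)
      moreover have "degree (pderiv f) < degree f" using deg_f by (simp add: degree_pderiv)
      ultimately have "poly (real_poly (pderiv f)) \<alpha> \<noteq> 0"
        using minimal[of "pderiv f"] by linarith
      then have "order \<alpha> (pderiv (real_poly f)) = 0" by (simp add: real_poly_pderiv order_root)
      then show ?thesis using order_pderiv[of "real_poly f" \<alpha>] \<open>f \<noteq> 0\<close> root by simp
    qed
    moreover have "order x (real_poly q) + degree f * order \<alpha> (real_poly q) \<le> degree q"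
      using less.hyps[of q] deg deg_f q by simp
    ultimately show ?thesis unfolding ord deg by simp
  qed
qed

lemma degree_eq_if_wronskian_0:
  fixes r v :: "real poly"
  assumes "r \<noteq> 0" "v \<noteq> 0" and eq: "r * pderiv v = pderiv r * v"
  shows "degree r = degree v"
proof (cases "pderiv v = 0 \<or> pderiv r = 0")
  case True
  then have "pderiv v = 0" "pderiv r = 0" using assms by auto
  then show ?thesis by (simp add: pderiv_eq_0_iff)
next
  case False
  have lead: "lead_coeff (pderiv p) = of_nat (degree p) * lead_coeff p"
    if "pderiv p \<noteq> 0" for p :: "real poly"
    using that by (simp add: degree_pderiv coeff_pderiv pderiv_eq_0_iff)
  from arg_cong[OF eq, of lead_coeff]
  have "lead_coeff r * lead_coeff (pderiv v) = lead_coeff (pderiv r) * lead_coeff v"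
    by (simp only: lead_coeff_mult)
  moreover have "pderiv v \<noteq> 0" "pderiv r \<noteq> 0" using False by auto
  ultimately show ?thesis using assms(1,2) unfolding lead[OF \<open>pderiv v \<noteq> 0\<close>] lead[OF \<open>pderiv r \<noteq> 0\<close>]
    by simp
qed

text \<open>The equation is preserved when a multiple of \<open>v\<close> is subtracted from
  \<open>r\<close>. Cancelling the leading coefficient in this way leaves a solution that, if
  nonzero, would again have the degree of \<open>v\<close>.\<close>

lemma proportional_if_wronskian_0:
  fixes r v :: "real poly"
  assumes "r \<noteq> 0" "v \<noteq> 0" and eq: "r * pderiv v = pderiv r * v"
  shows "\<exists>c. c \<noteq> 0 \<and> r = smult c v"
proof (intro exI conjI)
  define c where "c = lead_coeff r / lead_coeff v"
  show "lead_coeff r / lead_coeff v \<noteq> 0" using assms by simp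
  have c: "c \<noteq> 0" using assms by (simp add: c_def)
  have deg: "degree r = degree v" using degree_eq_if_wronskian_0[OF assms] .
  define s where "s = r - smult c v"
  have "s * pderiv v = pderiv s * v"
    using eq by (simp add: s_def pderiv_diff pderiv_smult algebra_simps)
  moreover have "coeff s (degree v) = 0"
    using assms(2) by (simp add: s_def deg c_def)
  moreover have "degree s \<le> degree v" unfolding s_def by (intro degree_diff_le) (auto simp: deg)
  ultimately have "s = 0" using degree_eq_if_wronskian_0[of s v] assms(2)
    by (metis leading_coeff_0_iff)
  then show "r = smult (lead_coeff r / lead_coeff v) v" by (simp add: s_def c_def)
qed

lemma linear_power_dvd_wronskian:
  fixes r v :: "real poly"
  assumes "[:- a, 1:] ^ Suc n dvd r"
  shows "[:- a, 1:] ^ n dvd r * pderiv v - pderiv r * v"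
proof -
  define t where "t = [:- a, 1:]"
  obtain s where s: "r = t ^ Suc n * s" using assms unfolding t_def by (elim dvdE)
  have "t ^ n dvd r" unfolding s by simp
  moreover have "t ^ n dvd pderiv r"
    unfolding s pderiv_mult pderiv_power_Suc by (simp add: dvd_smult)
  ultimately show ?thesis unfolding t_def[symmetric] by simp
qed

text \<open>The Wronskian of \<open>U\<close> and \<open>V\<close> inherits the high order zero at \<open>\<alpha>\<close>, so its degree leaves only
  room for a zero of low order at a further point.\<close>

lemma nonvanishing_taylor_coeff:
  fixes f U V :: "int poly" and \<alpha> x y :: real
  assumes "f \<noteq> 0" and root: "poly (real_poly f) \<alpha> = 0"
    and minimal: "\<And>g. g \<noteq> 0 \<Longrightarrow> poly (real_poly g) \<alpha> = 0 \<Longrightarrow> degree f \<le> degree g"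
    and x: "poly (real_poly f) x \<noteq> 0" and irrational: "\<alpha> \<notin> \<rat>"
    and UV: "U \<noteq> 0 \<or> V \<noteq> 0" "degree U < E" "degree V < E"
    and vanish: "\<And>j. j < N \<Longrightarrow> taylor_coeff \<alpha> (real_poly U - smult \<alpha> (real_poly V)) j = 0"
    and "E \<le> degree f * N" "2 * E \<le> M + degree f * (N - 1)" "M > 0" "N > 0"
  shows "\<exists>j<M. taylor_coeff x (real_poly U - smult y (real_poly V)) j \<noteq> 0"
proof (rule ccontr)
  assume "\<not> ?thesis"
  then have vanish_x: "\<And>j. j < M \<Longrightarrow> taylor_coeff x (real_poly U - smult y (real_poly V)) j = 0" by blast
  define R where "R = real_poly U - smult \<alpha> (real_poly V)"
  define W where "W = U * pderiv V - pderiv U * V"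
  \<comment> \<open>The Wronskian does not change when a multiple of \<open>V\<close> is subtracted
    from \<open>U\<close>; \<open>c = \<alpha>\<close> shows its zero at \<open>\<alpha>\<close>,
    and \<open>c = y\<close> the one at \<open>x\<close>.\<close>
  have wronskian: "real_poly W =
      (real_poly U - smult c (real_poly V)) * pderiv (real_poly V)
       - pderiv (real_poly U - smult c (real_poly V)) * real_poly V" for c
    by (simp add: W_def real_poly_diff real_poly_mult real_poly_pderiv pderiv_diff pderiv_smult algebra_simps)
  have R_dvd: "[:- \<alpha>, 1:] ^ N dvd R"
    unfolding R_def by (rule linear_power_dvd_if_taylor_coeff_0[OF vanish])
  \<comment> \<open>\<open>E \<le> degree f * N\<close> makes a zero of order \<open>N\<close> at
    \<open>\<alpha>\<close> too expensive for a single integer polynomial. This rules out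
    \<open>V = 0\<close> and proportionality of \<open>R\<close> and \<open>V\<close>.\<close>
  have no_zero: "\<not> [:- \<alpha>, 1:] ^ N dvd real_poly p" if "p \<noteq> 0" "degree p < E" for p
  proof
    assume "[:- \<alpha>, 1:] ^ N dvd real_poly p"
    then have "N \<le> order \<alpha> (real_poly p)" using that by (simp add: order_divides)
    then have "degree f * N \<le> degree f * order \<alpha> (real_poly p)" by simp
    also have "\<dots> \<le> degree p"
      using order_add_order_le_degree[OF assms(1) root minimal x that(1)] by linarith
    finally show False using that(2) assms(10) by simp
  qed
  have "R \<noteq> 0"
  proof
    assume "R = 0"
    then have eq: "real_of_int (coeff U i) = \<alpha> * of_int (coeff V i)" for i
    proof -
      have "coeff R i = 0" using \<open>R = 0\<close> by simp
      then show ?thesis by (simp add: R_def)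
    qed
    have "coeff V i = 0" for i
    proof (rule ccontr)
      assume "coeff V i \<noteq> 0"
      then have "\<alpha> = of_int (coeff U i) / of_int (coeff V i)" using eq[of i] by (simp add: field_simps)
      then show False using irrational by simp
    qed
    then show False using UV(1) eq by (metis mult_zero_right of_int_0 of_int_eq_0_iff poly_eqI coeff_0)
  qed
  have "V \<noteq> 0"
    using no_zero[of U] UV R_dvd by (auto simp: R_def)
  have "W \<noteq> 0"
  proof
    assume "W = 0"
    then have "R * pderiv (real_poly V) = pderiv R * real_poly V"
      using wronskian[of \<alpha>] by (simp add: R_def)
    then obtain c where "c \<noteq> 0" "R = smult c (real_poly V)"
      using proportional_if_wronskian_0[of R "real_poly V"] \<open>R \<noteq> 0\<close> \<open>V \<noteq> 0\<close> by auto
    then have "[:- \<alpha>, 1:] ^ N dvd real_poly V" using R_dvd by (simp add: dvd_smult_iff)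
    then show False using no_zero[of V] \<open>V \<noteq> 0\<close> UV by blast
  qed
  have "[:- \<alpha>, 1:] ^ (N - 1) dvd real_poly W"
    unfolding wronskian[of \<alpha>] using R_dvd \<open>N > 0\<close> by (intro linear_power_dvd_wronskian) (simp add: R_def)
  then have "N - 1 \<le> order \<alpha> (real_poly W)" using \<open>W \<noteq> 0\<close> by (simp add: order_divides)
  then have ord_\<alpha>: "degree f * (N - 1) \<le> degree f * order \<alpha> (real_poly W)" by simp
  have "[:- x, 1:] ^ M dvd real_poly U - smult y (real_poly V)"
    by (rule linear_power_dvd_if_taylor_coeff_0[OF vanish_x])
  then have "[:- x, 1:] ^ (M - 1) dvd real_poly W"
    unfolding wronskian[of y] using \<open>M > 0\<close> by (intro linear_power_dvd_wronskian) simp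
  then have ord_x: "M - 1 \<le> order x (real_poly W)" using \<open>W \<noteq> 0\<close> by (simp add: order_divides)
  have "degree W \<le> 2 * (E - 1)"
  proof -
    have "degree (U * pderiv V) \<le> 2 * (E - 1)" "degree (pderiv U * V) \<le> 2 * (E - 1)"
      using UV degree_mult_le[of U "pderiv V"] degree_mult_le[of "pderiv U" V]
      by (auto simp: degree_pderiv)
    then show ?thesis unfolding W_def by (rule degree_diff_le)
  qed
  moreover have "order x (real_poly W) + degree f * order \<alpha> (real_poly W) \<le> degree W"
    by (rule order_add_order_le_degree[OF assms(1) root minimal x \<open>W \<noteq> 0\<close>])
  ultimately show False using ord_\<alpha> ord_x assms(11) \<open>M > 0\<close> UV(2) by linarith
qed

text \<open>The number \<open>U\<^sub>j(x) - y V\<^sub>j(x)\<close>, with \<open>U\<^sub>j\<close> and \<open>V\<^sub>j\<close> the \<open>j\<close>-th Taylor coefficients at \<open>x\<close>, is a nonzero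
  rational with denominator dividing \<open>q1 ^ E * q2\<close>, but it is small if \<open>x\<close> and \<open>y\<close> are close to \<open>\<alpha>\<close>.\<close>

lemma approximation_pair_inequality:
  fixes f :: "int poly" and \<alpha> :: real and l :: nat
  assumes "f \<noteq> 0" and root: "poly (real_poly f) \<alpha> = 0"
    and minimal: "\<And>g. g \<noteq> 0 \<Longrightarrow> poly (real_poly g) \<alpha> = 0 \<Longrightarrow> degree f \<le> degree g"
    and deg: "degree f = d" "d > 0" and irrational: "\<alpha> \<notin> \<rat>" and "l > 0"
  obtains Z :: real where "Z \<ge> 1"
    "\<And>k p1 q1 p2 q2. k > 0 \<Longrightarrow> q1 > 0 \<Longrightarrow> q2 > 0 \<Longrightarrow> \<bar>of_int p1 / of_nat q1 - \<alpha>\<bar> \<le> 1 \<Longrightarrow>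
      poly (real_poly f) (of_int p1 / of_nat q1) \<noteq> 0 \<Longrightarrow>
      \<exists>j<2 * k + d. 1 \<le> Z ^ k * real q1 ^ ((d * l + 1) * k) * real q2 *
        (\<bar>of_int p1 / of_nat q1 - \<alpha>\<bar> ^ (2 * l * k - j) + \<bar>of_int p2 / of_nat q2 - \<alpha>\<bar>)"
proof -
  define G where "G = real_of_int (1 + \<bar>lead_coeff f\<bar> + (\<Sum>i\<le>degree f. \<bar>coeff f i\<bar>))"
  have "0 \<le> (\<Sum>i\<le>degree f. \<bar>coeff f i\<bar>)" by (simp add: sum_nonneg)
  then have "1 \<le> 1 + \<bar>lead_coeff f\<bar> + (\<Sum>i\<le>degree f. \<bar>coeff f i\<bar>)" by linarith
  then have G: "G \<ge> 1" unfolding G_def by (metis of_int_1 of_int_le_iff)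
  define A where "A = 2 + \<bar>\<alpha>\<bar>"
  have A: "A \<ge> 1" by (simp add: A_def)
  \<comment> \<open>\<open>Y ^ E\<close> collects all losses: the height of \<open>U\<close> and
    \<open>V\<close>, the factor \<open>16 ^ E = 2 ^ E * 2 ^ E * 4 ^ E\<close> from twice
    \<open>E \<le> 2 ^ E\<close> and twice a binomial coefficient, and \<open>A ^ (2 * E)\<close>
    from the size of the base points.\<close>
  define Y where "Y = (16 * G) ^ (d * l) * 16 * A\<^sup>2"
  have Y: "Y \<ge> 1"
  proof -
    have "1 \<le> (16 * G) ^ (d * l)" "1 \<le> A\<^sup>2" by (rule one_le_power; use G A in simp)+
    then have "1 * 1 * 1 \<le> (16 * G) ^ (d * l) * 16 * A\<^sup>2" by (intro mult_mono) auto
    then show ?thesis by (simp add: Y_def)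
  qed
  show thesis
  proof (rule that[of "Y ^ (d * l + 1)"])
    show "Y ^ (d * l + 1) \<ge> 1" using Y by (rule one_le_power)
    fix k q1 q2 :: nat and p1 p2 :: int
    assume k: "k > 0" and q: "q1 > 0" "q2 > 0" and close: "\<bar>of_int p1 / of_nat q1 - \<alpha>\<bar> \<le> 1"
      and x: "poly (real_poly f) (of_int p1 / of_nat q1) \<noteq> 0"
    define E where "E = (d * l + 1) * k"
    define H where "H = ((16 * G) ^ E) ^ (d * l)"
    define x where "x = real_of_int p1 / of_nat q1"
    define y where "y = real_of_int p2 / of_nat q2"
    have E: "E > 0" using k by (simp add: E_def)
    have H: "H \<ge> 0" using G by (simp add: H_def)
    obtain U V :: "int poly" where UV: "U \<noteq> 0 \<or> V \<noteq> 0" "degree U < E" "degree V < E"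
      and cU: "\<And>i. \<bar>real_of_int (coeff U i)\<bar> \<le> H"
      and cV: "\<And>i. \<bar>real_of_int (coeff V i)\<bar> \<le> H"
      and vanish: "\<And>j. j < 2 * l * k \<Longrightarrow> taylor_coeff \<alpha> (real_poly U - smult \<alpha> (real_poly V)) j = 0"
      using auxiliary_polynomials[OF root deg k \<open>l > 0\<close>] unfolding G_def H_def E_def by metis
    have dl: "d * l > 0" using deg \<open>l > 0\<close> by simp
    have "E \<le> degree f * (2 * l * k)"
    proof -
      have "d * l + 1 \<le> 2 * (d * l)" using dl by linarith
      then have "E \<le> 2 * (d * l) * k" unfolding E_def by (rule mult_le_mono1)
      then show ?thesis by (simp add: deg mult_ac)
    qed
    \<comment> \<open>An equality, as \<open>k\<close> and \<open>l\<close> are positive; it is the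
      source of the bound \<open>2 * k + d\<close> on \<open>j\<close>.\<close>
    moreover have "2 * E \<le> (2 * k + d) + degree f * (2 * l * k - 1)"
      by (simp add: E_def deg diff_mult_distrib2 algebra_simps)
    ultimately have "\<exists>j<2 * k + d. taylor_coeff x (real_poly U - smult y (real_poly V)) j \<noteq> 0"
      using k \<open>l > 0\<close> x unfolding x_def
      by (intro nonvanishing_taylor_coeff[OF assms(1) root minimal _ irrational UV, where N = "2 * l * k"] vanish)
        auto
    then obtain j where j: "j < 2 * k + d" "taylor_coeff x (real_poly U - smult y (real_poly V)) j \<noteq> 0"
      by blast
    have tc_diff: "taylor_coeff x (real_poly U - smult c (real_poly V)) j
        = taylor_coeff x (real_poly U) j - c * taylor_coeff x (real_poly V) j" for c
      by (simp add: taylor_coeff_def pcompose_diff pcompose_smult)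
    define T where "T = taylor_coeff x (real_poly U - smult y (real_poly V)) j"
    have lower: "1 \<le> \<bar>T\<bar> * real q1 ^ E * real q2"
    proof -
      obtain u v :: int where "taylor_coeff x (real_poly U) j * real q1 ^ E = of_int u"
        "taylor_coeff x (real_poly V) j * real q1 ^ E = of_int v"
        using taylor_coeff_integral[OF UV(2) q(1)] taylor_coeff_integral[OF UV(3) q(1)]
        unfolding x_def by metis
      then have "T * real q1 ^ E * real q2 = of_int (u * int q2 - p2 * v)"
        using q by (simp add: T_def tc_diff y_def field_simps)
      moreover have "T * real q1 ^ E * real q2 \<noteq> 0" using j(2) q by (simp add: T_def)
      moreover have "1 \<le> \<bar>real_of_int z\<bar>" if "real_of_int z \<noteq> 0" for z
      proof -
        have "1 \<le> \<bar>z\<bar>" using that by (cases "z = 0") auto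
        then show ?thesis by (metis of_int_1_le_iff of_int_abs)
      qed
      ultimately have "1 \<le> \<bar>T * real q1 ^ E * real q2\<bar>" by metis
      then show ?thesis by (simp add: abs_mult)
    qed
    define \<Xi> where "\<Xi> = (Y ^ (d * l + 1)) ^ k"
    have \<Xi>: "\<Xi> = H * 16 ^ E * A ^ (2 * E)"
    proof -
      have "\<Xi> = Y ^ E" unfolding \<Xi>_def E_def by (rule power_mult[symmetric])
      also have "\<dots> = H * 16 ^ E * A ^ (2 * E)"
        by (simp add: Y_def H_def power_mult_distrib power_mult[symmetric] mult_ac)
      finally show ?thesis .
    qed
    have nE: "real E \<le> 2 ^ E" using less_exp[of E] by (metis less_imp_le of_nat_le_iff of_nat_numeral of_nat_power)
    define R where "R = real_poly U - smult \<alpha> (real_poly V)"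
    have degR: "degree R < E" using UV unfolding R_def by (intro degree_diff_less) auto
    have "\<bar>coeff R i\<bar> \<le> H * A" for i
    proof -
      have "\<bar>coeff R i\<bar> \<le> \<bar>real_of_int (coeff U i)\<bar> + \<bar>\<alpha>\<bar> * \<bar>real_of_int (coeff V i)\<bar>"
        unfolding abs_mult[symmetric] by (simp add: R_def)
      also have "\<dots> \<le> H + \<bar>\<alpha>\<bar> * H" by (intro add_mono mult_left_mono cU cV) auto
      also have "\<dots> \<le> H * A" using H by (simp add: A_def algebra_simps)
      finally show ?thesis .
    qed
    from taylor_coeff_bound[OF degR this, of \<alpha>]
    have tR: "\<bar>taylor_coeff \<alpha> R i\<bar> \<le> E * (H * A * 2 ^ E * (1 + \<bar>\<alpha>\<bar>) ^ E)" for i .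
    have "\<bar>taylor_coeff x R j\<bar> \<le> E * (E * (H * A * 2 ^ E * (1 + \<bar>\<alpha>\<bar>) ^ E) * 2 ^ E * \<bar>x - \<alpha>\<bar> ^ (2 * l * k - j))"
      by (rule taylor_coeff_bound_near_zero[OF degR tR])
        (use vanish close in \<open>auto simp: R_def x_def\<close>)
    also have "\<dots> = (real E * real E) * (H * 4 ^ E) * (A * (1 + \<bar>\<alpha>\<bar>) ^ E) * \<bar>x - \<alpha>\<bar> ^ (2 * l * k - j)"
    proof -
      have "(4::real) ^ E = 2 ^ E * 2 ^ E" by (simp add: power_mult_distrib[symmetric])
      then show ?thesis by simp
    qed
    also have "\<dots> \<le> (2 ^ E * 2 ^ E) * (H * 4 ^ E) * (A ^ E * A ^ E) * \<bar>x - \<alpha>\<bar> ^ (2 * l * k - j)"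
    proof -
      have "A \<le> A ^ E" using A E by (simp add: self_le_power)
      moreover have "(1 + \<bar>\<alpha>\<bar>) ^ E \<le> A ^ E" by (intro power_mono) (auto simp: A_def)
      ultimately show ?thesis using nE H A by (intro mult_right_mono mult_mono) auto
    qed
    also have "(2 ^ E * 2 ^ E) * (H * 4 ^ E) * (A ^ E * A ^ E) = \<Xi>"
    proof -
      have "(16::real) ^ E = 2 ^ E * 2 ^ E * 4 ^ E" by (simp add: power_mult_distrib[symmetric])
      then show ?thesis by (simp add: \<Xi> mult_2 power_add)
    qed
    finally have 1: "\<bar>taylor_coeff x R j\<bar> \<le> \<Xi> * \<bar>x - \<alpha>\<bar> ^ (2 * l * k - j)" .
    have "\<bar>taylor_coeff x (real_poly V) j\<bar> \<le> E * (H * 2 ^ E * (1 + \<bar>x\<bar>) ^ E)"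
      using UV cV by (intro taylor_coeff_bound) auto
    also have "\<dots> \<le> 2 ^ E * (H * 2 ^ E * A ^ E)"
    proof -
      have "1 + \<bar>x\<bar> \<le> A" using close by (simp add: x_def[symmetric] A_def)
      then show ?thesis using nE H A by (intro mult_mono power_mono) auto
    qed
    also have "\<dots> = H * 4 ^ E * A ^ E"
    proof -
      have "(4::real) ^ E = 2 ^ E * 2 ^ E" by (simp add: power_mult_distrib[symmetric])
      then show ?thesis by simp
    qed
    also have "\<dots> \<le> \<Xi>"
      unfolding \<Xi> using H A by (intro mult_mono power_mono power_increasing mult_nonneg_nonneg) auto
    finally have 2: "\<bar>taylor_coeff x (real_poly V) j\<bar> \<le> \<Xi>" .
    \<comment> \<open>\<open>U - y V = (U - \<alpha> V) - (y - \<alpha>) V\<close>: the first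
      summand is small by its zero at \<open>\<alpha>\<close>, the second because \<open>y\<close>
      is close to \<open>\<alpha>\<close>.\<close>
    have "\<bar>T\<bar> \<le> \<bar>taylor_coeff x R j\<bar> + \<bar>taylor_coeff x (real_poly V) j\<bar> * \<bar>y - \<alpha>\<bar>"
    proof -
      have "T = taylor_coeff x R j - taylor_coeff x (real_poly V) j * (y - \<alpha>)"
        by (simp add: T_def R_def tc_diff algebra_simps)
      then show ?thesis unfolding abs_mult[symmetric] by linarith
    qed
    also have "\<dots> \<le> \<Xi> * \<bar>x - \<alpha>\<bar> ^ (2 * l * k - j) + \<Xi> * \<bar>y - \<alpha>\<bar>"
      by (intro add_mono 1 mult_right_mono 2) auto
    finally have "\<bar>T\<bar> \<le> \<Xi> * (\<bar>x - \<alpha>\<bar> ^ (2 * l * k - j) + \<bar>y - \<alpha>\<bar>)" by (simp add: distrib_left)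
    then have "\<bar>T\<bar> * real q1 ^ E * real q2 \<le>
        \<Xi> * (\<bar>x - \<alpha>\<bar> ^ (2 * l * k - j) + \<bar>y - \<alpha>\<bar>) * real q1 ^ E * real q2"
      by (intro mult_right_mono) auto
    with lower have "1 \<le> \<Xi> * real q1 ^ E * real q2 * (\<bar>x - \<alpha>\<bar> ^ (2 * l * k - j) + \<bar>y - \<alpha>\<bar>)"
      by (simp add: mult_ac)
    then show "\<exists>j<2 * k + d. 1 \<le> (Y ^ (d * l + 1)) ^ k * real q1 ^ ((d * l + 1) * k) * real q2 *
        (\<bar>of_int p1 / of_nat q1 - \<alpha>\<bar> ^ (2 * l * k - j) + \<bar>of_int p2 / of_nat q2 - \<alpha>\<bar>)"
      using j(1) unfolding \<Xi>_def E_def x_def y_def by blast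
  qed
qed

section \<open>Comparison of two approximations\<close>

text \<open>With \<open>N = 2 l k\<close> and \<open>q2\<close> between \<open>q1^N\<close> and
  \<open>q1^(N + 2 l)\<close>, the pair inequality becomes a comparison of exponents of
  \<open>q1\<close>. Its main terms are \<open>2 \<kappa> l k\<close> against
  \<open>(d + 2) l k\<close>, a contradiction for \<open>2 \<kappa> \<ge> d + 3\<close> as soon as
  \<open>l k\<close> exceeds the lower terms. Both approximations come from the negated claim, so no
  explicit \<open>Q\<close> results.\<close>

lemma thue_approximation_minimal:
  fixes f :: "int poly" and \<alpha> C :: real and \<kappa> :: nat
  assumes "f \<noteq> 0" and root: "poly (real_poly f) \<alpha> = 0"
    and minimal: "\<And>g. g \<noteq> 0 \<Longrightarrow> poly (real_poly g) \<alpha> = 0 \<Longrightarrow> degree f \<le> degree g"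
    and irrational: "\<alpha> \<notin> \<rat>" and \<kappa>: "degree f + 3 \<le> 2 * \<kappa>"
  shows "\<exists>Q. \<forall>q\<ge>Q. \<forall>p::int. q > 0 \<longrightarrow> \<bar>of_int p / of_nat q - \<alpha>\<bar> > C / of_nat q ^ \<kappa>"
proof (rule ccontr)
  assume neg: "\<not> ?thesis"
  define B where "B = max 1 C"
  have B: "B \<ge> 1" "C \<le> B" by (simp_all add: B_def)
  have approx: "\<exists>q p. q \<ge> Q \<and> q > 0 \<and> \<bar>of_int p / of_nat q - \<alpha>\<bar> \<le> B / of_nat q ^ \<kappa>" for Q :: nat
  proof -
    obtain q p where qp: "q \<ge> Q" "q > 0" "\<bar>of_int p / of_nat q - \<alpha>\<bar> \<le> C / of_nat q ^ \<kappa>"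
      using neg by (metis linorder_not_less)
    moreover have "C / of_nat q ^ \<kappa> \<le> B / of_nat q ^ \<kappa>" using B(2) by (intro divide_right_mono) auto
    ultimately show ?thesis using order_trans by blast
  qed
  define d where "d = degree f"
  \<comment> \<open>The spare term \<open>l * k\<close> has to beat
    \<open>2 * \<kappa> * k + 2 * k\<close>. This choice leaves another \<open>k\<close>, which
    \<open>K\<close> below makes larger than the constant terms
    \<open>\<kappa> * d + 2 * l\<close>.\<close>
  define l where "l = 2 * \<kappa> + 3"
  have d: "d > 0"
  proof (rule ccontr)
    assume "\<not> d > 0"
    then obtain c where "f = [:c:]" by (metis d_def degree_eq_zeroE gr0I)
    then show False using root \<open>f \<noteq> 0\<close> by (simp add: map_poly_pCons)
  qed
  obtain Z where Z: "Z \<ge> 1" and key: "\<And>k p1 q1 p2 q2. k > 0 \<Longrightarrow> q1 > 0 \<Longrightarrow> q2 > 0 \<Longrightarrow>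
      \<bar>of_int p1 / of_nat q1 - \<alpha>\<bar> \<le> 1 \<Longrightarrow> poly (real_poly f) (of_int p1 / of_nat q1) \<noteq> 0 \<Longrightarrow>
      \<exists>j<2 * k + d. 1 \<le> Z ^ k * real q1 ^ ((d * l + 1) * k) * real q2 *
        (\<bar>of_int p1 / of_nat q1 - \<alpha>\<bar> ^ (2 * l * k - j) + \<bar>of_int p2 / of_nat q2 - \<alpha>\<bar>)"
    using approximation_pair_inequality[OF assms(1) root minimal d_def[symmetric] d irrational, of l]
    unfolding l_def by (metis add_gr_0 zero_less_numeral)
  \<comment> \<open>Chosen so that \<open>c ^ k = Z ^ k * B ^ N\<close>; as
    \<open>q1 \<ge> 2 c\<close>, all constants together cost one factor
    \<open>q1 ^ k\<close>.\<close>
  define c where "c = Z * B ^ (2 * l)"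
  have c: "c \<ge> 1" using Z B one_le_power[of B "2 * l"] mult_mono[of 1 Z 1 "B ^ (2 * l)"] by (simp add: c_def)
  have \<kappa>0: "\<kappa> > 0" using \<kappa> by simp
  \<comment> \<open>The distance \<open>\<delta>\<close> to the other real roots of \<open>f\<close>
    will keep the first approximation from being a root.\<close>
  have "finite {x. poly (real_poly f) x = 0}" using \<open>f \<noteq> 0\<close> by (intro poly_roots_finite) simp
  then have "finite ((\<lambda>x. \<bar>x - \<alpha>\<bar>) ` ({x. poly (real_poly f) x = 0} - {\<alpha>}))" by blast
  then obtain \<delta> where \<delta>: "\<delta> > 0" "\<And>x. poly (real_poly f) x = 0 \<Longrightarrow> x \<noteq> \<alpha> \<Longrightarrow> \<delta> \<le> \<bar>x - \<alpha>\<bar>"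
  proof -
    assume fin: "finite ((\<lambda>x. \<bar>x - \<alpha>\<bar>) ` ({x. poly (real_poly f) x = 0} - {\<alpha>}))" (is "finite ?D")
    define \<delta> where "\<delta> = Min (insert 1 ?D)"
    have "\<delta> \<in> insert 1 ?D" unfolding \<delta>_def using fin by (intro Min_in) auto
    then have "\<delta> > 0" by auto
    moreover have "\<delta> \<le> \<bar>x - \<alpha>\<bar>" if "poly (real_poly f) x = 0" "x \<noteq> \<alpha>" for x
      unfolding \<delta>_def using fin that by (intro Min_le) auto
    ultimately show ?thesis using that by blast
  qed
  obtain q1 p1 where q1: "q1 \<ge> nat \<lceil>2 * c + B + B / \<delta>\<rceil> + 2"
    and p1: "\<bar>of_int p1 / of_nat q1 - \<alpha>\<bar> \<le> B / of_nat q1 ^ \<kappa>" using approx by blast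
  have "real q1 \<ge> 2 * c + B + B / \<delta> + 2" using q1 by linarith
  moreover have "B / \<delta> > 0" using B \<delta> by simp
  ultimately have q1': "real q1 \<ge> 2 * c" "real q1 > B" "real q1 > B / \<delta>" "real q1 \<ge> 2"
    using c B by linarith+
  define x where "x = real_of_int p1 / of_nat q1"
  have "B / real q1 ^ \<kappa> \<le> B / real q1"
    using B q1' \<kappa>0 self_le_power[of "real q1" \<kappa>] by (intro divide_left_mono) auto
  then have x_close: "\<bar>x - \<alpha>\<bar> \<le> B / real q1" using p1 unfolding x_def by linarith
  have "B / real q1 \<le> 1" using q1' by simp
  then have x_le1: "\<bar>x - \<alpha>\<bar> \<le> 1" using x_close by linarith
  have "B / real q1 < \<delta>" using q1' \<delta>(1) by (simp add: field_simps)
  moreover have "x \<noteq> \<alpha>" using irrational by (auto simp: x_def)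
  ultimately have fx: "poly (real_poly f) x \<noteq> 0" using \<delta>(2)[of x] x_close by linarith
  define K where "K = \<kappa> * d + 2 * l + 1"
  obtain q2 p2 where q2: "q2 \<ge> (q1 ^ (2 * l)) ^ K" "q2 > 0"
    and p2: "\<bar>of_int p2 / of_nat q2 - \<alpha>\<bar> \<le> B / of_nat q2 ^ \<kappa>" using approx by blast
  define y where "y = real_of_int p2 / of_nat q2"
  have l0: "l > 0" by (simp add: l_def)
  have b2: "q1 ^ (2 * l) \<ge> 2"
  proof -
    have "q1 \<ge> 2" using q1'(4) by simp
    moreover have "q1 ^ 1 \<le> q1 ^ (2 * l)" using calculation l0 by (intro power_increasing) auto
    ultimately show ?thesis by simp
  qed
  \<comment> \<open>The order of vanishing \<open>2 * l * k\<close> is matched to \<open>log q2 / log q1\<close>, which balances the two error terms.\<close>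
  obtain k where k: "(q1 ^ (2 * l)) ^ k \<le> q2" "q2 < (q1 ^ (2 * l)) ^ (k + 1)"
    using ex_power_ivl1[OF b2, of q2] q2(2) by auto
  have kK: "k \<ge> K"
  proof -
    have "(q1 ^ (2 * l)) ^ K < (q1 ^ (2 * l)) ^ (k + 1)" using q2(1) k(2) by linarith
    then have "K < k + 1" using b2 by (subst (asm) power_strict_increasing_iff) auto
    then show ?thesis by simp
  qed
  have k0: "k > 0" using kK by (simp add: K_def)
  define N where "N = 2 * l * k"
  define M where "M = 2 * k + d"
  have "k \<ge> d"
  proof -
    have "d \<le> \<kappa> * d" using \<kappa>0 by simp
    then show ?thesis using kK unfolding K_def by linarith
  qed
  have MN: "M \<le> N"
  proof -
    have "3 \<le> 2 * l" by (simp add: l_def)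
    then have "3 * k \<le> 2 * l * k" by (rule mult_le_mono1)
    then show ?thesis using \<open>k \<ge> d\<close> unfolding M_def N_def by linarith
  qed
  have q2_lower: "real q1 ^ N \<le> real q2"
    using k(1) unfolding N_def by (metis of_nat_le_iff of_nat_power power_mult)
  have q2_upper: "real q2 \<le> real q1 ^ (N + 2 * l)"
  proof -
    have "q2 \<le> q1 ^ (N + 2 * l)" using k(2) by (simp add: N_def power_mult[symmetric] power_add mult_ac less_imp_le)
    then show ?thesis by (metis of_nat_le_iff of_nat_power)
  qed
  define Q where "Q = real q1"
  have Q: "Q \<ge> 2" "Q \<ge> 2 * c" using q1' by (simp_all add: Q_def)
  obtain j where j: "j < M" and ineq: "1 \<le> Z ^ k * Q ^ ((d * l + 1) * k) * real q2 *
      (\<bar>x - \<alpha>\<bar> ^ (N - j) + \<bar>y - \<alpha>\<bar>)"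
    using key[of k q1 q2 p1 p2] k0 q2(2) q1'(4) x_le1 fx unfolding M_def N_def Q_def x_def y_def by auto
  have BN: "0 < B ^ N" using B by simp
  have term1: "\<bar>x - \<alpha>\<bar> ^ (N - j) \<le> B ^ N / Q ^ (\<kappa> * (N - M))"
  proof -
    have "\<bar>x - \<alpha>\<bar> ^ (N - j) \<le> \<bar>x - \<alpha>\<bar> ^ (N - M)" using x_le1 j by (intro power_decreasing) auto
    also have "\<dots> \<le> (B / Q ^ \<kappa>) ^ (N - M)" using p1 by (intro power_mono) (auto simp: x_def Q_def)
    also have "\<dots> = B ^ (N - M) / Q ^ (\<kappa> * (N - M))" by (simp add: power_divide power_mult)
    also have "\<dots> \<le> B ^ N / Q ^ (\<kappa> * (N - M))"
      using B Q by (intro divide_right_mono power_increasing) auto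
    finally show ?thesis .
  qed
  have term2: "\<bar>y - \<alpha>\<bar> \<le> B ^ N / Q ^ (\<kappa> * (N - M))"
  proof -
    have "\<bar>y - \<alpha>\<bar> \<le> B / real q2 ^ \<kappa>" using p2 by (simp add: y_def)
    also have "\<dots> \<le> B / (Q ^ N) ^ \<kappa>"
      using B Q q2_lower q2(2) by (intro divide_left_mono power_mono mult_pos_pos) (auto simp: Q_def)
    also have "\<dots> \<le> B / Q ^ (\<kappa> * (N - M))"
    proof -
      have "Q ^ (\<kappa> * (N - M)) \<le> Q ^ (N * \<kappa>)" using Q by (intro power_increasing) auto
      then show ?thesis using B Q by (intro divide_left_mono) (auto simp: power_mult)
    qed
    also have "\<dots> \<le> B ^ N / Q ^ (\<kappa> * (N - M))"
      using B Q self_le_power[of B N] k0 l0 by (intro divide_right_mono) (auto simp: N_def)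
    finally show ?thesis .
  qed
  have "1 \<le> Z ^ k * Q ^ ((d * l + 1) * k) * real q2 * (2 * (B ^ N / Q ^ (\<kappa> * (N - M))))"
    using Z Q term1 term2 by (intro order_trans[OF ineq] mult_left_mono) auto
  also have "\<dots> \<le> Z ^ k * Q ^ ((d * l + 1) * k) * Q ^ (N + 2 * l) * (2 * (B ^ N / Q ^ (\<kappa> * (N - M))))"
    using Z Q BN q2_upper by (intro mult_left_mono mult_right_mono) (auto simp: Q_def)
  also have "\<dots> = 2 * c ^ k * Q ^ ((d * l + 1) * k + (N + 2 * l)) / Q ^ (\<kappa> * (N - M))"
    by (simp add: c_def N_def power_mult_distrib power_mult power_add)
  finally have "Q ^ (\<kappa> * (N - M)) \<le> 2 * c ^ k * Q ^ ((d * l + 1) * k + (N + 2 * l))"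
    using Q by (simp add: field_simps)
  also have "2 * c ^ k \<le> Q ^ k"
  proof -
    have "2 * c ^ k \<le> 2 ^ k * c ^ k" using k0 c by (intro mult_right_mono) (auto simp: self_le_power)
    also have "\<dots> \<le> Q ^ k" unfolding power_mult_distrib[symmetric] using Q c by (intro power_mono) auto
    finally show ?thesis .
  qed
  finally have "Q ^ (\<kappa> * (N - M)) \<le> Q ^ (k + ((d * l + 1) * k + (N + 2 * l)))"
    using Q by (simp only: power_add[of Q k]) (simp add: mult_right_mono)
  then have "\<kappa> * (N - M) \<le> k + ((d * l + 1) * k + (N + 2 * l))"
    using Q by (subst (asm) power_increasing_iff) auto
  then have "\<kappa> * N \<le> \<kappa> * M + k + (d * l + 1) * k + N + 2 * l"
    using MN by (simp add: diff_mult_distrib2)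
  then have A: "2 * \<kappa> * (l * k) \<le> 2 * (\<kappa> * k) + \<kappa> * d + 2 * k + d * (l * k) + 2 * (l * k) + 2 * l"
    by (simp add: N_def M_def algebra_simps)
  have "(d + 3) * (l * k) \<le> 2 * \<kappa> * (l * k)" using \<kappa> by (intro mult_le_mono1) (simp add: d_def)
  then have "l * k \<le> 2 * (\<kappa> * k) + \<kappa> * d + 2 * k + 2 * l" using A by (simp add: distrib_right)
  moreover have "l * k = 2 * (\<kappa> * k) + 3 * k" by (simp add: l_def algebra_simps)
  ultimately have "k \<le> \<kappa> * d + 2 * l" by linarith
  then show False using kK by (simp add: K_def)
qed

theorem thue_approximation:
  fixes f :: "int poly" and \<alpha> C :: real and \<kappa> :: nat
  assumes "f \<noteq> 0" and root: "poly (real_poly f) \<alpha> = 0"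
    and irrational: "\<alpha> \<notin> \<rat>" and \<kappa>: "degree f + 3 \<le> 2 * \<kappa>"
  shows "\<exists>Q. \<forall>q\<ge>Q. \<forall>p::int. q > 0 \<longrightarrow> \<bar>of_int p / of_nat q - \<alpha>\<bar> > C / of_nat q ^ \<kappa>"
proof -
  obtain g where g: "g \<noteq> 0 \<and> poly (real_poly g) \<alpha> = 0"
    and min: "\<And>h. h \<noteq> 0 \<and> poly (real_poly h) \<alpha> = 0 \<Longrightarrow> degree g \<le> degree h"
    using ex_has_least_nat[of "\<lambda>g. g \<noteq> 0 \<and> poly (real_poly g) \<alpha> = 0" f degree] assms by blast
  then have "degree g \<le> degree f" using assms by blast
  then show ?thesis using g min irrational \<kappa> by (intro thue_approximation_minimal[of g]) auto
qed

section \<open>Quartic Thue equations\<close>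

lemma Bseq_subseq_convergent:
  fixes X :: "nat \<Rightarrow> real"
  assumes "\<And>n. \<bar>X n\<bar> \<le> K"
  obtains r L where "strict_mono r" "(X \<circ> r) \<longlonglongrightarrow> L"
proof -
  obtain r where r: "strict_mono r" "monoseq (X \<circ> r)"
    using seq_monosub[of X] by (auto simp: o_def)
  have "Bseq (X \<circ> r)" using assms by (intro BseqI'[of _ K]) simp
  then have "convergent (X \<circ> r)" using r(2) by (rule Bseq_monoseq_convergent)
  then show thesis using that r(1) by (auto simp: convergent_def)
qed

text \<open>Binary quartic forms are written \<open>a X^4 + 4 b X^3 Y + 6 c X^2 Y^2 + 4 d X Y^3 + e Y^4\<close>, so that
  the invariants and the Hessian have integral coefficients in \<open>a, \<dots>, e\<close>.\<close>

type_synonym 'a quartic = "'a \<times> 'a \<times> 'a \<times> 'a \<times> 'a"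

fun qf_eval :: "'a::comm_ring_1 quartic \<Rightarrow> 'a \<Rightarrow> 'a \<Rightarrow> 'a" where
  "qf_eval (a, b, c, d, e) x y = a * x^4 + 4 * b * x^3 * y + 6 * c * x^2 * y^2 + 4 * d * x * y^3 + e * y^4"

fun qf_I :: "'a::comm_ring_1 quartic \<Rightarrow> 'a" where
  "qf_I (a, b, c, d, e) = a * e - 4 * b * d + 3 * c^2"

fun qf_J :: "'a::comm_ring_1 quartic \<Rightarrow> 'a" where
  "qf_J (a, b, c, d, e) = a * c * e + 2 * b * c * d - a * d^2 - b^2 * e - c^3"

text \<open>Translating the double root to the origin gives a form with \<open>d = e = 0\<close> and
  middle coefficient \<open>W = a z^2 + 2 b z + c\<close>, whose invariants are \<open>3 W^2\<close>
  and \<open>- (W^3)\<close>. Up to a constant, \<open>I^3 - 27 J^2\<close> is the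
  discriminant.\<close>

lemma double_root_imp_disc_0:
  fixes a b c d e z :: real
  assumes "a * z^4 + 4 * b * z^3 + 6 * c * z^2 + 4 * d * z + e = 0"
    and "a * z^3 + 3 * b * z^2 + 3 * c * z + d = 0"
  shows "qf_I (a, b, c, d, e) ^ 3 = 27 * qf_J (a, b, c, d, e) ^ 2"
proof -
  have d: "d = - (a * z^3 + 3 * b * z^2 + 3 * c * z)" using assms(2) by simp
  have e: "e = 3 * a * z^4 + 8 * b * z^3 + 6 * c * z^2"
    using assms(1) unfolding d by (simp add: algebra_simps power_numeral_reduce)
  have I: "qf_I (a, b, c, d, e) = 3 * (a * z^2 + 2 * b * z + c)^2"
    unfolding d e by (simp add: algebra_simps power_numeral_reduce)
  have J: "qf_J (a, b, c, d, e) = - ((a * z^2 + 2 * b * z + c)^3)"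
    unfolding d e by (simp add: algebra_simps power_numeral_reduce)
  have "27 * (- (W ^ 3))\<^sup>2 = (3 * W\<^sup>2) ^ 3" for W :: real
    by (simp add: power_mult_distrib power_mult[symmetric])
  then show ?thesis unfolding I J by simp
qed

text \<open>Covers the limits that Thue's theorem does not: a fraction with denominator
  \<open>q\<close> other than \<open>\<alpha> = m / n\<close> has distance at least
  \<open>1 / (n q)\<close> from it.\<close>

lemma rational_approximation_gap:
  fixes \<alpha> K :: real
  assumes "\<alpha> \<in> \<rat>"
  shows "\<exists>Q. \<forall>q\<ge>Q. \<forall>p::int. q > 0 \<longrightarrow> of_int p / of_nat q \<noteq> \<alpha> \<longrightarrow> \<bar>of_int p / of_nat q - \<alpha>\<bar> > K / of_nat q ^ 4"
proof -
  obtain m n where mn: "n > 0" "\<alpha> = of_int m / of_nat n" using Rats_cases'[OF assms] 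
    by (metis of_int_of_nat_eq pos_int_cases)
  show ?thesis
  proof (intro exI allI impI)
    fix q :: nat and p :: int
    assume q: "q \<ge> nat \<lceil>\<bar>K\<bar> * n\<rceil> + 1" "q > 0" "of_int p / of_nat q \<noteq> \<alpha>"
    have eq: "of_int p / of_nat q - \<alpha> = of_int (p * int n - m * int q) / (real q * real n)"
      using mn q(2) by (simp add: field_simps)
    have "p * int n - m * int q \<noteq> 0"
    proof
      assume "p * int n - m * int q = 0"
      then have "of_int p / of_nat q - \<alpha> = 0" unfolding eq by (simp only: of_int_0 div_0)
      then show False using q(3) by simp
    qed
    then have "1 \<le> \<bar>p * int n - m * int q\<bar>" by linarith
    then have "1 \<le> \<bar>real_of_int (p * int n - m * int q)\<bar>" by (metis of_int_1_le_iff of_int_abs)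
    then have gap: "\<bar>of_int p / of_nat q - \<alpha>\<bar> \<ge> 1 / (real q * real n)"
      unfolding eq abs_divide using mn q(2) by (simp add: divide_right_mono)
    have "K * n \<le> \<bar>K\<bar> * n" by (intro mult_right_mono) auto
    also have "\<dots> < real q" using q(1) by linarith
    also have "\<dots> \<le> real q ^ 3" using q(2) by (intro self_le_power) auto
    finally have "K * n < real q ^ 3" .
    then have "K / real q ^ 4 < 1 / (real q * real n)"
      using mn q(2) by (simp add: field_simps power_numeral_reduce)
    then show "K / real q ^ 4 < \<bar>of_int p / of_nat q - \<alpha>\<bar>" using gap by linarith
  qed
qed

text \<open>The restriction \<open>\<bar>p\<bar> \<le> \<bar>q\<bar>\<close> keeps
  \<open>p / q\<close> bounded, so infinitely many solutions accumulate at some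
  \<open>\<alpha>\<close>, which is a root since the form takes the value \<open>1 / q^4\<close> at
  \<open>(p / q, 1)\<close>. The discriminant makes the root simple, so the distance is
  \<open>O(q^-4)\<close>, against Thue's theorem with \<open>\<kappa> = 4\<close>.\<close>

lemma thue_quartic_half:
  fixes h :: "int quartic"
  assumes disc: "qf_I h ^ 3 \<noteq> 27 * qf_J h ^ 2"
  shows "finite {(p, q). qf_eval h p q = 1 \<and> \<bar>p\<bar> \<le> \<bar>q\<bar>}"
proof (rule ccontr)
  assume inf: "infinite {(p, q). qf_eval h p q = 1 \<and> \<bar>p\<bar> \<le> \<bar>q\<bar>}"
  obtain a b c d e where h: "h = (a, b, c, d, e)" by (cases h)
  define H where "H z = of_int a * z^4 + 4 * of_int b * z^3 + 6 * of_int c * z^2 + 4 * of_int d * z + of_int e"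
    for z :: real
  have ex: "\<exists>p q. qf_eval h p (int q) = 1 \<and> \<bar>p\<bar> \<le> int q \<and> q > n" for n
  proof (rule ccontr)
    assume neg: "\<not> ?thesis"
    have "{(p, q). qf_eval h p q = 1 \<and> \<bar>p\<bar> \<le> \<bar>q\<bar>} \<subseteq> {- int n..int n} \<times> {- int n..int n}"
    proof clarify
      fix p q assume pq: "qf_eval h p q = 1" "\<bar>p\<bar> \<le> \<bar>q\<bar>"
      have "qf_eval h (- p) (- q) = 1" using pq(1) by (simp add: h)
      then have "\<exists>p'. qf_eval h p' (int (nat \<bar>q\<bar>)) = 1 \<and> \<bar>p'\<bar> \<le> int (nat \<bar>q\<bar>)"
        using pq by (cases "q \<ge> 0") (auto intro: exI[of _ p] exI[of _ "- p"])
      then have "\<bar>q\<bar> \<le> int n" using neg by (metis linorder_not_less nat_le_iff)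
      then show "p \<in> {- int n..int n} \<and> q \<in> {- int n..int n}" using pq(2) by auto
    qed
    then show False using inf finite_subset by blast
  qed
  then obtain p q where pq: "\<And>n::nat. qf_eval h (p n) (int (q n)) = 1" "\<And>n. \<bar>p n\<bar> \<le> int (q n)"
    "\<And>n. q n > n" by metis
  define X where "X n = real_of_int (p n) / real (q n)" for n
  have q0: "q n > 0" for n using pq(3)[of n] by simp
  have "\<bar>X n\<bar> \<le> 1" for n
  proof -
    have "\<bar>real_of_int (p n)\<bar> \<le> real (q n)" using pq(2)[of n] by (metis of_int_abs of_int_le_iff of_int_of_nat_eq)
    then show ?thesis using q0[of n] by (simp add: X_def)
  qed
  then obtain r \<alpha> where r: "strict_mono r" and lim: "(X \<circ> r) \<longlonglongrightarrow> \<alpha>" by (rule Bseq_subseq_convergent)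
  have HX: "H (X n) = 1 / real (q n) ^ 4" for n
  proof -
    have "H (X n) * real (q n) ^ 4 = real_of_int (qf_eval h (p n) (int (q n)))"
      using q0[of n] by (simp add: H_def X_def h field_simps power_numeral_reduce)
    then show ?thesis using pq(1)[of n] q0[of n] by (simp add: field_simps)
  qed
  have qr: "filterlim (\<lambda>n. real (q (r n))) at_top sequentially"
  proof (rule filterlim_at_top_mono)
    show "filterlim real at_top sequentially" by (rule filterlim_real_sequentially)
    show "\<forall>\<^sub>F n in sequentially. real n \<le> real (q (r n))"
      using pq(3) seq_suble[OF r] by (intro always_eventually allI) (metis less_imp_le of_nat_le_iff order_trans)
  qed
  have "(\<lambda>n. H (X (r n))) \<longlonglongrightarrow> 0"
  proof -
    have "(\<lambda>n. inverse (real (q (r n))) ^ 4) \<longlonglongrightarrow> 0 ^ 4"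
      by (intro tendsto_power tendsto_inverse_0_at_top qr)
    then show ?thesis by (simp add: HX divide_inverse power_inverse)
  qed
  moreover have "(\<lambda>n. H (X (r n))) \<longlonglongrightarrow> H \<alpha>"
    using lim unfolding H_def o_def by (intro tendsto_intros)
  ultimately have H\<alpha>: "H \<alpha> = 0" using LIMSEQ_unique by blast
  define m where "m = 4 * (of_int a * \<alpha>^3 + 3 * of_int b * \<alpha>^2 + 3 * of_int c * \<alpha> + of_int d)"
  have "m \<noteq> 0"
  proof
    assume "m = 0"
    then have "qf_I (real_of_int a, real_of_int b, real_of_int c, real_of_int d, real_of_int e) ^ 3 =
      27 * qf_J (real_of_int a, real_of_int b, real_of_int c, real_of_int d, real_of_int e) ^ 2"
      using H\<alpha> unfolding m_def H_def by (intro double_root_imp_disc_0[of _ \<alpha>]) auto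
    then have "real_of_int (qf_I h ^ 3) = real_of_int (27 * qf_J h ^ 2)" by (simp add: h)
    then show False using disc by (simp only: of_int_eq_iff)
  qed
  \<comment> \<open>The divided difference \<open>H z / (z - \<alpha>)\<close>; its value at
    \<open>\<alpha>\<close> is the derivative \<open>m\<close>.\<close>
  define S where "S z = of_int a * (z^3 + z^2 * \<alpha> + z * \<alpha>^2 + \<alpha>^3) + 4 * of_int b * (z^2 + z * \<alpha> + \<alpha>^2)
      + 6 * of_int c * (z + \<alpha>) + 4 * of_int d" for z
  have fact: "H z = (z - \<alpha>) * S z" for z
  proof -
    have "H z = H z - H \<alpha>" by (simp add: H\<alpha>)
    also have "\<dots> = (z - \<alpha>) * S z" unfolding H_def S_def by (simp add: algebra_simps power_numeral_reduce)
    finally show ?thesis .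
  qed
  have "(\<lambda>n. \<bar>S (X (r n))\<bar>) \<longlonglongrightarrow> \<bar>S \<alpha>\<bar>"
    using lim unfolding S_def o_def by (intro tendsto_intros)
  moreover have "S \<alpha> = m" by (simp add: S_def m_def algebra_simps power_numeral_reduce)
  ultimately have "\<forall>\<^sub>F n in sequentially. \<bar>S (X (r n))\<bar> > \<bar>m\<bar> / 2"
    using \<open>m \<noteq> 0\<close> by (intro order_tendstoD(1)) auto
  then have close: "\<forall>\<^sub>F n in sequentially. \<bar>X (r n) - \<alpha>\<bar> \<le> (2 / \<bar>m\<bar>) / real (q (r n)) ^ 4"
  proof eventually_elim
    fix n assume S: "\<bar>S (X (r n))\<bar> > \<bar>m\<bar> / 2"
    have "\<bar>X (r n) - \<alpha>\<bar> * (\<bar>m\<bar> / 2) \<le> \<bar>X (r n) - \<alpha>\<bar> * \<bar>S (X (r n))\<bar>"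
      using S by (intro mult_left_mono) auto
    also have "\<dots> = 1 / real (q (r n)) ^ 4" using HX[of "r n"] by (simp add: fact abs_mult[symmetric])
    finally have "\<bar>X (r n) - \<alpha>\<bar> \<le> (1 / real (q (r n)) ^ 4) / (\<bar>m\<bar> / 2)"
      using \<open>m \<noteq> 0\<close> by (subst pos_le_divide_eq) auto
    then show "\<bar>X (r n) - \<alpha>\<bar> \<le> (2 / \<bar>m\<bar>) / real (q (r n)) ^ 4" by (simp add: mult.commute)
  qed
  have neq: "X n \<noteq> \<alpha>" for n
    using HX[of n] H\<alpha> q0[of n] by auto
  have "\<exists>Q. \<forall>q\<ge>Q. \<forall>p::int. q > 0 \<longrightarrow> of_int p / of_nat q \<noteq> \<alpha> \<longrightarrow> \<bar>of_int p / of_nat q - \<alpha>\<bar> > (2 / \<bar>m\<bar>) / of_nat q ^ 4"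
  proof (cases "\<alpha> \<in> \<rat>")
    case True
    then show ?thesis by (rule rational_approximation_gap)
  next
    case False
    define f where "f = [:e, 4 * d, 6 * c, 4 * b, a:]"
    have "poly (real_poly f) z = H z" for z
      by (simp add: f_def H_def map_poly_pCons algebra_simps power_numeral_reduce)
    moreover have "f \<noteq> 0" using disc by (auto simp: f_def h)
    moreover have "degree f \<le> 4" by (auto simp: f_def)
    ultimately show ?thesis using thue_approximation[of f \<alpha> 4 "2 / \<bar>m\<bar>"] H\<alpha> False by auto
  qed
  then obtain Q where Q: "\<And>q p. q \<ge> Q \<Longrightarrow> q > 0 \<Longrightarrow> of_int p / of_nat q \<noteq> \<alpha> \<Longrightarrow>
      \<bar>of_int p / of_nat q - \<alpha>\<bar> > (2 / \<bar>m\<bar>) / of_nat q ^ 4" by blast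
  have "\<forall>\<^sub>F n in sequentially. real (q (r n)) \<ge> real Q"
    using qr unfolding filterlim_at_top by (rule spec)
  with close have "\<forall>\<^sub>F n in sequentially. False"
  proof eventually_elim
    fix n assume "\<bar>X (r n) - \<alpha>\<bar> \<le> (2 / \<bar>m\<bar>) / real (q (r n)) ^ 4" "real (q (r n)) \<ge> real Q"
    then show False using Q[of "q (r n)" "p (r n)"] q0[of "r n"] neq[of "r n"] unfolding X_def by auto
  qed
  then show False by simp
qed

theorem thue_quartic:
  fixes h :: "int quartic"
  assumes disc: "qf_I h ^ 3 \<noteq> 27 * qf_J h ^ 2"
  shows "finite {(p, q). qf_eval h p q = 1}"
proof -
  obtain a b c d e where h: "h = (a, b, c, d, e)" by (cases h)
  define h' where "h' = (e, d, c, b, a)"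
  have "qf_I h' = qf_I h" "qf_J h' = qf_J h" by (simp_all add: h h'_def algebra_simps)
  then have "finite {(p, q). qf_eval h' p q = 1 \<and> \<bar>p\<bar> \<le> \<bar>q\<bar>}"
    using disc by (intro thue_quartic_half) simp
  then have "finite (prod.swap ` {(p, q). qf_eval h' p q = 1 \<and> \<bar>p\<bar> \<le> \<bar>q\<bar>})" by (rule finite_imageI)
  moreover have "{(p, q). qf_eval h p q = 1} \<subseteq> {(p, q). qf_eval h p q = 1 \<and> \<bar>p\<bar> \<le> \<bar>q\<bar>}
     \<union> prod.swap ` {(p, q). qf_eval h' p q = 1 \<and> \<bar>p\<bar> \<le> \<bar>q\<bar>}"
    (is "_ \<subseteq> _ \<union> ?T")
  proof
    fix z assume "z \<in> {(p, q). qf_eval h p q = 1}"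
    then obtain p q where z: "z = (p, q)" "qf_eval h p q = 1" by auto
    then have "qf_eval h' q p = 1" by (simp add: h h'_def algebra_simps)
    then have "z \<in> ?T" if "\<bar>q\<bar> \<le> \<bar>p\<bar>" using z that by (intro image_eqI[of _ _ "(q, p)"]) auto
    then show "z \<in> {(p, q). qf_eval h p q = 1 \<and> \<bar>p\<bar> \<le> \<bar>q\<bar>} \<union> ?T"
      using z by (cases "\<bar>q\<bar> \<le> \<bar>p\<bar>") auto
  qed
  ultimately show ?thesis using thue_quartic_half[OF disc] by (meson finite_Un finite_subset)
qed

section \<open>Integral points on cubic curves\<close>

text \<open>Substitution of \<open>p X + q Y\<close> and \<open>r X + s Y\<close> for the variables,
  in coefficients freed from the factors 1, 4, 6, 4, 1.\<close>

fun qf_act :: "'a::comm_ring_1 quartic \<Rightarrow> 'a \<Rightarrow> 'a \<Rightarrow> 'a \<Rightarrow> 'a \<Rightarrow> 'a quartic" where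
  "qf_act (a, b, c, d, e) p q r s =
    (a * p^4 + 4 * b * p^3 * r + 6 * c * p^2 * r^2 + 4 * d * p * r^3 + e * r^4,
     a * p^3 * q + b * (p^3 * s + 3 * p^2 * r * q) + c * (3 * p^2 * r * s + 3 * p * r^2 * q)
       + d * (3 * p * r^2 * s + r^3 * q) + e * r^3 * s,
     a * p^2 * q^2 + 2 * b * (p^2 * q * s + p * r * q^2) + c * (p^2 * s^2 + 4 * p * r * q * s + r^2 * q^2)
       + 2 * d * (p * r * s^2 + r^2 * q * s) + e * r^2 * s^2,
     a * p * q^3 + b * (3 * p * q^2 * s + r * q^3) + c * (3 * p * q * s^2 + 3 * r * q^2 * s)
       + d * (p * s^3 + 3 * r * q * s^2) + e * r * s^3,
     a * q^4 + 4 * b * q^3 * s + 6 * c * q^2 * s^2 + 4 * d * q * s^3 + e * s^4)"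

text \<open>The determinant of the second derivatives, divided by 144.\<close>

fun qf_hessian :: "'a::comm_ring_1 quartic \<Rightarrow> 'a \<Rightarrow> 'a \<Rightarrow> 'a" where
  "qf_hessian (a, b, c, d, e) x y = (a * c - b^2) * x^4 + 2 * (a * d - b * c) * x^3 * y
    + (a * e + 2 * b * d - 3 * c^2) * x^2 * y^2 + 2 * (b * e - c * d) * x * y^3 + (c * e - d^2) * y^4"

lemma qf_I_act:
  fixes h :: "int quartic"
  shows "qf_I (qf_act h p q r s) = (p * s - q * r) ^ 4 * qf_I h"
proof (cases h)
  case (fields a b c d e)
  show ?thesis unfolding fields qf_act.simps qf_I.simps by algebra
qed

lemma qf_J_act:
  fixes h :: "int quartic"
  shows "qf_J (qf_act h p q r s) = (p * s - q * r) ^ 6 * qf_J h"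
proof (cases h)
  case (fields a b c d e)
  show ?thesis unfolding fields qf_act.simps qf_J.simps by algebra
qed

lemma qf_eval_act_inverse:
  fixes a b c d e :: int
  shows "qf_eval (qf_act (a, b, c, d, e) p q r s) s (- r) = (p * s - q * r) ^ 4 * a"
  unfolding qf_act.simps qf_eval.simps by algebra

text \<open>For determinant 1 the substitution sends \<open>(s, -r)\<close> to
  \<open>(1, 0)\<close>, so there the covariants of the new form take the leading coefficients of
  the old ones. For the form attached to \<open>(x, y)\<close> the leading coefficient of the
  Hessian is \<open>- x\<close>.\<close>

lemma qf_hessian_act_inverse:
  fixes a b c d e :: int
  shows "qf_hessian (qf_act (a, b, c, d, e) p q r s) s (- r) = (p * s - q * r) ^ 6 * (a * c - b^2)"
  unfolding qf_act.simps qf_hessian.simps by algebra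

lemma qf_act_act:
  fixes h :: "real quartic"
  shows "qf_act (qf_act h p q r s) p' q' r' s' =
    qf_act h (p * p' + q * r') (p * q' + q * s') (r * p' + s * r') (r * q' + s * s')"
proof (cases h)
  case (fields a b c d e)
  show ?thesis unfolding fields qf_act.simps prod.inject by (intro conjI; algebra)
qed

section \<open>Lattice reduction and bounded quartics\<close>

text \<open>Gauss reduction: a shortest vector is completed to a basis with scalar product
  \<open>B\<close> at most half its squared length. For the squared lengths
  \<open>m \<le> n\<close>, Lagrange's identity \<open>m n - B^2 = 1\<close> gives
  \<open>m n \<le> 1 + m^2 / 4 \<le> 1 + m n / 4\<close>.\<close>

lemma reduced_lattice_basis:
  fixes u\<^sub>0 v\<^sub>0 u\<^sub>1 v\<^sub>1 :: real
  assumes det: "u\<^sub>0 * v\<^sub>1 - u\<^sub>1 * v\<^sub>0 = 1"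
  obtains p q r s :: int where "p * s - q * r = 1"
    "(p * u\<^sub>0 + r * u\<^sub>1)\<^sup>2 + (p * v\<^sub>0 + r * v\<^sub>1)\<^sup>2 \<le> (q * u\<^sub>0 + s * u\<^sub>1)\<^sup>2 + (q * v\<^sub>0 + s * v\<^sub>1)\<^sup>2"
    "((p * u\<^sub>0 + r * u\<^sub>1)\<^sup>2 + (p * v\<^sub>0 + r * v\<^sub>1)\<^sup>2) * ((q * u\<^sub>0 + s * u\<^sub>1)\<^sup>2 + (q * v\<^sub>0 + s * v\<^sub>1)\<^sup>2) \<le> 4 / 3"
proof -
  define u where "u p r = of_int p * u\<^sub>0 + of_int r * u\<^sub>1" for p r :: int
  define v where "v p r = of_int p * v\<^sub>0 + of_int r * v\<^sub>1" for p r :: int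
  define n where "n p r = (u p r)\<^sup>2 + (v p r)\<^sup>2" for p r
  have det': "u p r * v q s - u q s * v p r = of_int (p * s - q * r)" for p q r s
  proof -
    have "u p r * v q s - u q s * v p r = of_int (p * s - q * r) * (u\<^sub>0 * v\<^sub>1 - u\<^sub>1 * v\<^sub>0)"
      by (simp add: u_def v_def algebra_simps)
    then show ?thesis by (simp add: det)
  qed
  have n0: "n p r > 0" if "(p, r) \<noteq> (0, 0)" for p r
  proof (rule ccontr)
    assume "\<not> n p r > 0"
    then have "u p r = 0 \<and> v p r = 0"
      unfolding n_def by (metis not_sum_power2_lt_zero sum_power2_eq_zero_iff linorder_neqE_linordered_idom)
    then show False using det'[of p r 0 1] det'[of p r 1 0] that by simp
  qed
  define S where "S = {(p, r). (p, r) \<noteq> (0, 0) \<and> n p r \<le> n 1 0}"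
  have "finite S"
  proof (rule finite_subset)
    define K where "K = (1 + n 1 0) * (\<bar>u\<^sub>0\<bar> + \<bar>u\<^sub>1\<bar> + \<bar>v\<^sub>0\<bar> + \<bar>v\<^sub>1\<bar>)"
    show "S \<subseteq> {- \<lceil>K\<rceil>..\<lceil>K\<rceil>} \<times> {- \<lceil>K\<rceil>..\<lceil>K\<rceil>}"
    proof clarify
      fix p r assume pr: "(p, r) \<in> S"
      have le: "\<bar>z\<bar> \<le> 1 + n 1 0" if "z\<^sup>2 \<le> n p r" for z
      proof -
        have "2 * \<bar>z\<bar> \<le> 1 + z\<^sup>2" using zero_le_power2[of "\<bar>z\<bar> - 1"] by (simp add: power2_eq_square algebra_simps)
        moreover have "z\<^sup>2 \<le> n 1 0" using that pr by (simp add: S_def)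
        moreover have "0 \<le> n 1 0" by (simp add: n_def)
        ultimately show ?thesis by linarith
      qed
      have uv: "\<bar>u p r\<bar> \<le> 1 + n 1 0" "\<bar>v p r\<bar> \<le> 1 + n 1 0" by (rule le; simp add: n_def)+
      have bound: "\<bar>u p r * y - v p r * x\<bar> \<le> K"
        if "\<bar>x\<bar> + \<bar>y\<bar> \<le> \<bar>u\<^sub>0\<bar> + \<bar>u\<^sub>1\<bar> + \<bar>v\<^sub>0\<bar> + \<bar>v\<^sub>1\<bar>" for x y
      proof -
        have "\<bar>u p r * y - v p r * x\<bar> \<le> \<bar>u p r\<bar> * \<bar>y\<bar> + \<bar>v p r\<bar> * \<bar>x\<bar>"
          unfolding abs_mult[symmetric] by linarith
        also have "\<dots> \<le> (1 + n 1 0) * \<bar>y\<bar> + (1 + n 1 0) * \<bar>x\<bar>"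
          by (intro add_mono mult_right_mono uv) auto
        also have "\<dots> = (1 + n 1 0) * (\<bar>x\<bar> + \<bar>y\<bar>)" by (simp add: algebra_simps)
        also have "\<dots> \<le> K" unfolding K_def by (intro mult_left_mono that) (simp add: n_def)
        finally show ?thesis .
      qed
      have "real_of_int p = u p r * v\<^sub>1 - v p r * u\<^sub>1" "- real_of_int r = u p r * v\<^sub>0 - v p r * u\<^sub>0"
        using det'[of p r 0 1] det'[of p r 1 0] by (simp_all add: u_def v_def mult.commute)
      then have "\<bar>real_of_int p\<bar> \<le> K" "\<bar>real_of_int r\<bar> \<le> K"
        using bound[of u\<^sub>1 v\<^sub>1] bound[of u\<^sub>0 v\<^sub>0] by simp_all
      then show "p \<in> {- \<lceil>K\<rceil>..\<lceil>K\<rceil>} \<and> r \<in> {- \<lceil>K\<rceil>..\<lceil>K\<rceil>}"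
        by (simp add: abs_le_iff) linarith
    qed
  qed simp
  moreover have "(1, 0) \<in> S" by (simp add: S_def)
  ultimately obtain z where z: "z \<in> S" "\<And>w. w \<in> S \<Longrightarrow> \<not> (case w of (p, r) \<Rightarrow> n p r) < (case z of (p, r) \<Rightarrow> n p r)"
    using arg_min_if_finite[of S "\<lambda>(p, r). n p r"] by (metis (no_types, lifting) empty_iff)
  obtain p r where zeq: "z = (p, r)" by (cases z)
  have pr: "(p, r) \<noteq> (0, 0)" "n p r \<le> n 1 0" using z(1) by (simp_all add: zeq S_def)
  have min: "n p r \<le> n q s" if "(q, s) \<noteq> (0, 0)" for q s
  proof (cases "(q, s) \<in> S")
    case True
    then show ?thesis using z(2)[of "(q, s)"] by (simp add: zeq)
  next
    case False
    then show ?thesis using that pr(2) by (auto simp: S_def)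
  qed
  \<comment> \<open>Division by the gcd would give a shorter vector, and a primitive vector extends
    to a basis.\<close>
  have "coprime p r"
  proof -
    define g where "g = gcd p r"
    define p' where "p' = p div g"
    define r' where "r' = r div g"
    have gpr: "p = g * p'" "r = g * r'" by (simp_all add: g_def p'_def r'_def)
    have "p \<noteq> 0 \<or> r \<noteq> 0" using pr(1) by simp
    then have g: "g > 0" unfolding g_def by simp
    have nz: "(p', r') \<noteq> (0, 0)"
    proof
      assume "(p', r') = (0, 0)"
      then have "p = 0" "r = 0" by (subst gpr, simp)+
      then show False using pr(1) by simp
    qed
    have "n p r = (of_int g)\<^sup>2 * n p' r'"
      unfolding gpr n_def u_def v_def by (simp add: power2_eq_square algebra_simps)
    then have "(of_int g)\<^sup>2 * n p' r' \<le> 1 * n p' r'" using min[OF nz] by simp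
    then have "(real_of_int g)\<^sup>2 \<le> 1" using n0[OF nz] by (simp only: mult_le_cancel_right_pos)
    then have "real_of_int g \<le> 1" using g by (simp add: power2_le_iff_abs_le abs_square_le_1)
    then have "g = 1" using g by simp
    then show ?thesis by (simp add: g_def coprime_iff_gcd_eq_1)
  qed
  then obtain s\<^sub>0 q\<^sub>0 where bezout: "s\<^sub>0 * p + q\<^sub>0 * r = 1" using bezout_int[of p r] by auto
  define B where "B q s = u p r * u q s + v p r * v q s" for q s
  \<comment> \<open>\<open>B\<close> is the scalar product with the shortest vector, which \<open>k\<close> makes as small as possible.\<close>
  define k where "k = - round (B (- q\<^sub>0) s\<^sub>0 / n p r)"
  define q where "q = - q\<^sub>0 + k * p"
  define s where "s = s\<^sub>0 + k * r"
  have det_pqrs: "p * s - q * r = 1" using bezout by (simp add: q_def s_def algebra_simps)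
  have np: "n p r > 0" using n0 pr(1) by simp
  have "B q s = B (- q\<^sub>0) s\<^sub>0 + of_int k * n p r"
    by (simp add: B_def q_def s_def u_def v_def n_def power2_eq_square algebra_simps)
  then have "B q s / n p r = B (- q\<^sub>0) s\<^sub>0 / n p r - of_int (round (B (- q\<^sub>0) s\<^sub>0 / n p r))"
    using np by (simp add: k_def field_simps)
  then have "\<bar>B q s / n p r\<bar> \<le> 1 / 2"
    using of_int_round_abs_le[of "B (- q\<^sub>0) s\<^sub>0 / n p r"] by (simp add: abs_minus_commute)
  then have "\<bar>B q s\<bar> \<le> n p r / 2" using np by (simp add: abs_divide field_simps)
  then have "(B q s)\<^sup>2 \<le> (n p r / 2)\<^sup>2" using np by (intro power2_le_iff_abs_le[THEN iffD2]) auto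
  moreover have "n p r * n q s - (B q s)\<^sup>2 = 1"
  proof -
    have "n p r * n q s - (B q s)\<^sup>2 = (u p r * v q s - u q s * v p r)\<^sup>2"
      by (simp add: n_def B_def power2_eq_square algebra_simps)
    then show ?thesis by (simp add: det' det_pqrs)
  qed
  moreover have le: "n p r \<le> n q s" using det_pqrs by (intro min) auto
  moreover have "(n p r / 2)\<^sup>2 \<le> n p r * n q s / 4"
    using mult_left_mono[OF le, of "n p r"] np by (simp add: power2_eq_square)
  ultimately have "n p r * n q s \<le> 4 / 3" by linarith
  then show thesis using that[OF det_pqrs] le by (simp add: n_def u_def v_def)
qed

lemma abs_monomial_le:
  fixes x y :: real
  assumes "\<bar>c\<bar> \<le> K" "\<bar>x\<bar> \<le> y"
  shows "\<bar>c * x\<bar> \<le> K * y"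
  unfolding abs_mult using assms by (intro mult_mono) auto

text \<open>Each new coefficient is the polarized form at four columns of the substitution, with
  \<open>n\<^sub>1\<close> bounding the first column and \<open>n\<^sub>2\<close> the second; it
  expands into 16 terms counted with multiplicity.\<close>

lemma qf_act_bound:
  fixes a b c d e :: real
  assumes K: "\<bar>a\<bar> \<le> K" "\<bar>b\<bar> \<le> K" "\<bar>c\<bar> \<le> K" "\<bar>d\<bar> \<le> K" "\<bar>e\<bar> \<le> K"
    and n: "\<bar>p\<bar> \<le> n\<^sub>1" "\<bar>r\<bar> \<le> n\<^sub>1" "\<bar>q\<bar> \<le> n\<^sub>2" "\<bar>s\<bar> \<le> n\<^sub>2"
    and h: "qf_act (a, b, c, d, e) p q r s = (a', b', c', d', e')"
  shows "\<bar>a'\<bar> \<le> 16 * K * n\<^sub>1 ^ 4" "\<bar>b'\<bar> \<le> 16 * K * (n\<^sub>1 ^ 3 * n\<^sub>2)" "\<bar>c'\<bar> \<le> 16 * K * (n\<^sub>1\<^sup>2 * n\<^sub>2\<^sup>2)"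
    "\<bar>d'\<bar> \<le> 16 * K * (n\<^sub>1 * n\<^sub>2 ^ 3)" "\<bar>e'\<bar> \<le> 16 * K * n\<^sub>2 ^ 4"
proof -
  have pos: "0 \<le> n\<^sub>1" "0 \<le> n\<^sub>2" using n by linarith+
  have mono: "\<bar>w * x * y * z\<bar> \<le> W * X * Y * Z"
    if "\<bar>w\<bar> \<le> W" "\<bar>x\<bar> \<le> X" "\<bar>y\<bar> \<le> Y" "\<bar>z\<bar> \<le> Z" for w x y z W X Y Z :: real
    unfolding abs_mult using that by (intro mult_mono mult_nonneg_nonneg) auto
  have t: "\<bar>c * (w * x * y * z)\<bar> \<le> K * (W * X * Y * Z)"
    if "\<bar>c\<bar> \<le> K" "\<bar>w\<bar> \<le> W" "\<bar>x\<bar> \<le> X" "\<bar>y\<bar> \<le> Y" "\<bar>z\<bar> \<le> Z" for c w x y z W X Y Z :: real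
    by (rule abs_monomial_le[OF that(1) mono[OF that(2-5)]])
  have eqs: "a' = a * (p*p*p*p) + 4 * (b * (p*p*p*r)) + 6 * (c * (p*p*r*r)) + 4 * (d * (p*r*r*r)) + e * (r*r*r*r)"
    "b' = a * (p*p*p*q) + b * (p*p*p*s) + 3 * (b * (p*p*r*q)) + 3 * (c * (p*p*r*s)) + 3 * (c * (p*r*r*q))
      + 3 * (d * (p*r*r*s)) + d * (r*r*r*q) + e * (r*r*r*s)"
    "c' = a * (p*p*q*q) + 2 * (b * (p*p*q*s)) + 2 * (b * (p*r*q*q)) + c * (p*p*s*s) + 4 * (c * (p*r*q*s))
      + c * (r*r*q*q) + 2 * (d * (p*r*s*s)) + 2 * (d * (r*r*q*s)) + e * (r*r*s*s)"
    "d' = a * (p*q*q*q) + 3 * (b * (p*q*q*s)) + b * (r*q*q*q) + 3 * (c * (p*q*s*s)) + 3 * (c * (r*q*q*s))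
      + d * (p*s*s*s) + 3 * (d * (r*q*s*s)) + e * (r*s*s*s)"
    "e' = a * (q*q*q*q) + 4 * (b * (q*q*q*s)) + 6 * (c * (q*q*s*s)) + 4 * (d * (q*s*s*s)) + e * (s*s*s*s)"
    using h by (auto simp: algebra_simps power_numeral_reduce)
  show "\<bar>a'\<bar> \<le> 16 * K * n\<^sub>1 ^ 4"
  proof -
    note T = t[OF K(1) n(1) n(1) n(1) n(1)] t[OF K(2) n(1) n(1) n(1) n(2)] t[OF K(3) n(1) n(1) n(2) n(2)]
      t[OF K(4) n(1) n(2) n(2) n(2)] t[OF K(5) n(2) n(2) n(2) n(2)]
    show ?thesis
      unfolding eqs using T[THEN abs_le_D1] T[THEN abs_le_D2]
      by (intro abs_leI; simp add: mult.assoc power4_eq_xxxx power3_eq_cube)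
  qed
  show "\<bar>b'\<bar> \<le> 16 * K * (n\<^sub>1 ^ 3 * n\<^sub>2)"
  proof -
    note T = t[OF K(1) n(1) n(1) n(1) n(3)] t[OF K(2) n(1) n(1) n(1) n(4)] t[OF K(2) n(1) n(1) n(2) n(3)]
      t[OF K(3) n(1) n(1) n(2) n(4)] t[OF K(3) n(1) n(2) n(2) n(3)] t[OF K(4) n(1) n(2) n(2) n(4)]
      t[OF K(4) n(2) n(2) n(2) n(3)] t[OF K(5) n(2) n(2) n(2) n(4)]
    show ?thesis
      unfolding eqs using T[THEN abs_le_D1] T[THEN abs_le_D2]
      by (intro abs_leI; simp add: mult.assoc power4_eq_xxxx power3_eq_cube)
  qed
  show "\<bar>c'\<bar> \<le> 16 * K * (n\<^sub>1\<^sup>2 * n\<^sub>2\<^sup>2)"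
  proof -
    note T = t[OF K(1) n(1) n(1) n(3) n(3)] t[OF K(2) n(1) n(1) n(3) n(4)] t[OF K(2) n(1) n(2) n(3) n(3)]
      t[OF K(3) n(1) n(1) n(4) n(4)] t[OF K(3) n(1) n(2) n(3) n(4)] t[OF K(3) n(2) n(2) n(3) n(3)]
      t[OF K(4) n(1) n(2) n(4) n(4)] t[OF K(4) n(2) n(2) n(3) n(4)] t[OF K(5) n(2) n(2) n(4) n(4)]
    show ?thesis
      unfolding eqs using T[THEN abs_le_D1] T[THEN abs_le_D2]
      by (intro abs_leI; simp add: mult.assoc power2_eq_square)
  qed
  show "\<bar>d'\<bar> \<le> 16 * K * (n\<^sub>1 * n\<^sub>2 ^ 3)"
  proof -
    note T = t[OF K(1) n(1) n(3) n(3) n(3)] t[OF K(2) n(1) n(3) n(3) n(4)] t[OF K(2) n(2) n(3) n(3) n(3)]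
      t[OF K(3) n(1) n(3) n(4) n(4)] t[OF K(3) n(2) n(3) n(3) n(4)] t[OF K(4) n(1) n(4) n(4) n(4)]
      t[OF K(4) n(2) n(3) n(4) n(4)] t[OF K(5) n(2) n(4) n(4) n(4)]
    show ?thesis
      unfolding eqs using T[THEN abs_le_D1] T[THEN abs_le_D2]
      by (intro abs_leI; simp add: mult.assoc power4_eq_xxxx power3_eq_cube)
  qed
  show "\<bar>e'\<bar> \<le> 16 * K * n\<^sub>2 ^ 4"
  proof -
    note T = t[OF K(1) n(3) n(3) n(3) n(3)] t[OF K(2) n(3) n(3) n(3) n(4)] t[OF K(3) n(3) n(3) n(4) n(4)]
      t[OF K(4) n(3) n(4) n(4) n(4)] t[OF K(5) n(4) n(4) n(4) n(4)]
    show ?thesis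
      unfolding eqs using T[THEN abs_le_D1] T[THEN abs_le_D2]
      by (intro abs_leI; simp add: mult.assoc power4_eq_xxxx power3_eq_cube)
  qed
qed

text \<open>For large \<open>x\<close> three roots of the quartic attached to \<open>(x, y)\<close> lie within \<open>O(x powr (-1/2))\<close>
  of \<open>- sqrt x\<close>. The unimodular substitution moves this cluster to the origin and
  stretches it to bounded size.\<close>

lemma mordell_quartic_bounded_coeffs:
  fixes x y g\<^sub>2 g\<^sub>3 :: int
  assumes curve: "y\<^sup>2 = 4 * x ^ 3 - g\<^sub>2 * x - g\<^sub>3" and "x \<ge> 1" "y \<le> 0"
  defines "G \<equiv> \<bar>real_of_int g\<^sub>2\<bar> + \<bar>real_of_int g\<^sub>3\<bar>"
  shows "\<exists>\<mu> D E :: real. \<mu> > 0 \<and> \<bar>D\<bar> \<le> G \<and> \<bar>E\<bar> \<le> G * G + 4 * G \<and>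
    qf_act (1 / of_int x, - 1, 0, D, E) \<mu> (of_int x / \<mu>) 0 (1 / \<mu>) =
      (1, 0, - of_int x, of_int y, of_int (g\<^sub>2 - 3 * x\<^sup>2))"
proof -
  define X where "X = real_of_int x"
  define w where "w = sqrt X"
  \<comment> \<open>For \<open>g\<^sub>2 = g\<^sub>3 = 0\<close> the quartic is
    \<open>(Z + w)^3 (Z - 3 w)\<close>. The new variable is
    \<open>\<mu>^2 (Z + w) = w (Z + w)\<close>, so a cluster of size \<open>O(1 / w)\<close> becomes
    bounded, while the fourth root moves out to about \<open>4 x\<close>.\<close>
  define \<mu> where "\<mu> = sqrt w"
  have X: "X \<ge> 1" using assms(2) by (simp add: X_def)
  have w: "w > 0" "w\<^sup>2 = X" using X by (simp_all add: w_def)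
  have \<mu>: "\<mu> > 0" "\<mu>\<^sup>2 = w" using w by (simp_all add: \<mu>_def)
  have \<mu>4: "\<mu> ^ 4 = X" using \<mu>(2) w(2) by (metis numeral_Bit0 power_add power2_eq_square)
  define s where "s = - real_of_int y * w"
  have s: "s \<ge> 0" using assms(3) w by (simp add: s_def mult_nonpos_nonneg)
  have curve': "(real_of_int y)\<^sup>2 = 4 * X ^ 3 - g\<^sub>2 * X - g\<^sub>3"
    using arg_cong[OF curve, of real_of_int] by (simp add: X_def)
  have s2: "s\<^sup>2 = 4 * X ^ 4 - g\<^sub>2 * X\<^sup>2 - g\<^sub>3 * X"
  proof -
    have "s\<^sup>2 = (real_of_int y)\<^sup>2 * X" by (simp add: s_def power_mult_distrib w)
    then show ?thesis unfolding curve' by (simp add: algebra_simps power_numeral_reduce)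
  qed
  \<comment> \<open>A difference of nearly equal numbers, as \<open>s^2\<close> is
    \<open>4 X^4\<close> up to order \<open>X^2\<close>. Multiplication by
    \<open>t = 2 X^2 + s\<close>, large because \<open>y \<le> 0\<close> makes \<open>s\<close>
    nonnegative, exposes the cancellation in \<open>D\<close> and then in \<open>E\<close>.\<close>
  define D where "D = 2 * X\<^sup>2 - s"
  define E where "E = X * (g\<^sub>2 - 4 * D)"
  define t where "t = 2 * X\<^sup>2 + s"
  have XX: "X \<le> X\<^sup>2" using X by (simp add: self_le_power)
  have t: "t \<ge> 2 * X\<^sup>2" "t > 0" using s X by (auto simp: t_def intro: add_pos_nonneg)
  have Dt: "D * t = g\<^sub>2 * X\<^sup>2 + g\<^sub>3 * X"
  proof -
    have "D * t = 4 * X ^ 4 - s\<^sup>2" by (simp add: D_def t_def algebra_simps power_numeral_reduce)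
    then show ?thesis by (simp add: s2)
  qed
  have G: "\<bar>real_of_int g\<^sub>2\<bar> \<le> G" "\<bar>real_of_int g\<^sub>3\<bar> \<le> G" "G \<ge> 0" by (simp_all add: G_def)
  have D: "\<bar>D\<bar> \<le> G"
  proof -
    have "\<bar>D\<bar> * t = \<bar>g\<^sub>2 * X\<^sup>2 + g\<^sub>3 * X\<bar>" unfolding Dt[symmetric] using t by (simp add: abs_mult)
    also have "\<dots> \<le> \<bar>real_of_int g\<^sub>2\<bar> * X\<^sup>2 + \<bar>real_of_int g\<^sub>3\<bar> * X"
      using X abs_triangle_ineq[of "g\<^sub>2 * X\<^sup>2" "g\<^sub>3 * X"] by (simp add: abs_mult)
    also have "\<dots> \<le> \<bar>real_of_int g\<^sub>2\<bar> * X\<^sup>2 + \<bar>real_of_int g\<^sub>3\<bar> * X\<^sup>2"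
      using XX by (intro add_left_mono mult_left_mono) auto
    also have "\<dots> = G * X\<^sup>2" by (simp add: G_def algebra_simps)
    also have "\<dots> \<le> G * t" using t(1) G(3) X by (intro mult_left_mono) (auto intro: order_trans[rotated])
    finally show ?thesis using t(2) by simp
  qed
  have E: "\<bar>E\<bar> \<le> G * G + 4 * G"
  proof -
    have "E * t = X * (g\<^sub>2 * t - 4 * (D * t))" by (simp add: E_def algebra_simps)
    also have "\<dots> = X * (- (g\<^sub>2 * D) - 4 * g\<^sub>3 * X)"
      unfolding Dt by (simp add: t_def D_def algebra_simps power_numeral_reduce)
    also have "\<dots> = - (X * (g\<^sub>2 * D + 4 * g\<^sub>3 * X))" by (simp add: algebra_simps)
    finally have Et: "E * t = - (X * (g\<^sub>2 * D + 4 * g\<^sub>3 * X))" .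
    have "\<bar>E\<bar> * t = \<bar>E * t\<bar>" using t(2) by (simp add: abs_mult)
    also have "\<dots> = X * \<bar>g\<^sub>2 * D + 4 * g\<^sub>3 * X\<bar>" unfolding Et using X by (simp add: abs_mult)
    also have "\<dots> \<le> X * (\<bar>real_of_int g\<^sub>2\<bar> * \<bar>D\<bar> + 4 * \<bar>real_of_int g\<^sub>3\<bar> * X)"
      using X abs_triangle_ineq[of "g\<^sub>2 * D" "4 * g\<^sub>3 * X"] by (intro mult_left_mono) (auto simp: abs_mult)
    also have "\<dots> \<le> X * (G * G * X + 4 * G * X)"
    proof (intro mult_left_mono add_mono mult_right_mono)
      have "\<bar>real_of_int g\<^sub>2\<bar> * \<bar>D\<bar> \<le> G * G" using G D by (intro mult_mono) auto
      also have "\<dots> \<le> G * G * X" using X G mult_left_mono[of 1 X "G * G"] by simp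
      finally show "\<bar>real_of_int g\<^sub>2\<bar> * \<bar>D\<bar> \<le> G * G * X" .
    qed (use X G in auto)
    also have "\<dots> = (G * G + 4 * G) * X\<^sup>2" by (simp add: power2_eq_square algebra_simps)
    also have "\<dots> \<le> (G * G + 4 * G) * t"
      using t(1) G(3) X by (intro mult_left_mono) (auto intro: order_trans[rotated])
    finally show ?thesis using t(2) by simp
  qed
  have "qf_act (1 / X, - 1, 0, D, E) \<mu> (X / \<mu>) 0 (1 / \<mu>) = (1, 0, - X, of_int y, g\<^sub>2 - 3 * X\<^sup>2)"
  proof -
    have L: "\<mu> * \<mu> * \<mu> * \<mu> = X" "\<mu> \<noteq> 0" "X \<noteq> 0" using \<mu>4 \<mu>(1) X by (auto simp: power4_eq_xxxx)
    have "D = 2 * X\<^sup>2 + of_int y * (\<mu> * \<mu>)" using \<mu>(2) by (simp add: D_def s_def power2_eq_square)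
    then have "D / (\<mu> * \<mu>) - 2 * X\<^sup>2 / (\<mu> * \<mu>) = of_int y" using L by (simp add: field_simps)
    moreover have "E / X + 4 * D = g\<^sub>2" using L by (simp add: E_def)
    moreover have "D * (X * 4) / X = 4 * D" using L by simp
    ultimately show ?thesis
      unfolding qf_act.simps prod.inject using L
      by (intro conjI; simp add: power_numeral_reduce field_simps)
  qed
  moreover have "real_of_int (g\<^sub>2 - 3 * x\<^sup>2) = g\<^sub>2 - 3 * X\<^sup>2" by (simp add: X_def)
  ultimately show ?thesis using \<mu>(1) D E unfolding X_def[symmetric] by metis
qed

lemma real_qf_act:
  "qf_act (a, b, c, d, e) p q r s = (a', b', c', d', e') \<Longrightarrow>
   qf_act (of_int a, of_int b, of_int c, of_int d, of_int e) (of_int p) (of_int q) (of_int r) (of_int s) =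
   (real_of_int a', real_of_int b', real_of_int c', real_of_int d', real_of_int e')"
  by (auto simp: power_numeral_reduce)

text \<open>If the shortest lattice vector were too short, the first two coefficients of the reduced form
  would be integers of absolute value below \<open>1\<close>, hence zero, and the discriminant would vanish.\<close>

lemma reduced_mordell_quartic:
  fixes x y g\<^sub>2 g\<^sub>3 :: int
  assumes curve: "y\<^sup>2 = 4 * x ^ 3 - g\<^sub>2 * x - g\<^sub>3" and "x \<ge> 1" "y \<le> 0"
    and disc: "g\<^sub>2 ^ 3 \<noteq> 27 * g\<^sub>3 ^ 2"
  defines "G \<equiv> \<bar>real_of_int g\<^sub>2\<bar> + \<bar>real_of_int g\<^sub>3\<bar>"
  defines "K \<equiv> 1 + G + G * G + 4 * G"
  obtains p q r s a b c d e :: int where "p * s - q * r = 1"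
    "qf_act (1, 0, - x, y, g\<^sub>2 - 3 * x\<^sup>2) p q r s = (a, b, c, d, e)"
    "\<forall>z\<in>{a, b, c, d, e}. \<bar>real_of_int z\<bar> \<le> 16 * K * (64 * K)\<^sup>2"
    "qf_I (a, b, c, d, e) = g\<^sub>2" "qf_J (a, b, c, d, e) = g\<^sub>3"
proof -
  have G: "G \<ge> 0" by (simp add: G_def)
  have K: "K \<ge> 1" "G \<le> K" "G * G + 4 * G \<le> K" using G by (simp_all add: K_def)
  obtain \<mu> D E where \<mu>: "\<mu> > 0" and DE: "\<bar>D\<bar> \<le> G" "\<bar>E\<bar> \<le> G * G + 4 * G"
    and act: "qf_act (1 / real_of_int x, - 1, 0, D, E) \<mu> (of_int x / \<mu>) 0 (1 / \<mu>) =
      (1, 0, - of_int x, of_int y, of_int (g\<^sub>2 - 3 * x\<^sup>2))"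
    using mordell_quartic_bounded_coeffs[OF assms(1-3)] unfolding G_def by blast
  \<comment> \<open>The lattice is spanned by the columns of the real substitution. Composing it
    with an integral one evaluates the bounded form at another lattice basis, so a reduced basis
    yields bounded coefficients.\<close>
  obtain p q r s :: int where det: "p * s - q * r = 1"
    and le: "(p * \<mu> + r * (x / \<mu>))\<^sup>2 + (p * 0 + r * (1 / \<mu>))\<^sup>2 \<le> (q * \<mu> + s * (x / \<mu>))\<^sup>2 + (q * 0 + s * (1 / \<mu>))\<^sup>2"
    and prod: "((p * \<mu> + r * (x / \<mu>))\<^sup>2 + (p * 0 + r * (1 / \<mu>))\<^sup>2) * ((q * \<mu> + s * (x / \<mu>))\<^sup>2 + (q * 0 + s * (1 / \<mu>))\<^sup>2) \<le> 4 / 3"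
    by (rule reduced_lattice_basis[of \<mu> "1 / \<mu>" "x / \<mu>" 0]) (use \<mu> in auto)
  obtain a b c d e where h: "qf_act (1, 0, - x, y, g\<^sub>2 - 3 * x\<^sup>2) p q r s = (a, b, c, d, e)"
    by (metis prod_cases5)
  have "qf_act (1, 0, - real_of_int x, real_of_int y, of_int (g\<^sub>2 - 3 * x\<^sup>2)) (of_int p) (of_int q) (of_int r) (of_int s)
      = (real_of_int a, real_of_int b, real_of_int c, real_of_int d, real_of_int e)"
    using real_qf_act[OF h] by simp
  then have h': "qf_act (1 / real_of_int x, - 1, 0, D, E) (\<mu> * p + x / \<mu> * r) (\<mu> * q + x / \<mu> * s)
      (0 * real_of_int p + 1 / \<mu> * r) (0 * real_of_int q + 1 / \<mu> * s)
      = (real_of_int a, real_of_int b, real_of_int c, real_of_int d, real_of_int e)"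
    unfolding act[symmetric] qf_act_act .
  define n\<^sub>1 where "n\<^sub>1 = sqrt ((\<mu> * p + x / \<mu> * r)\<^sup>2 + (0 * real_of_int p + 1 / \<mu> * r)\<^sup>2)"
  define n\<^sub>2 where "n\<^sub>2 = sqrt ((\<mu> * q + x / \<mu> * s)\<^sup>2 + (0 * real_of_int q + 1 / \<mu> * s)\<^sup>2)"
  have n12: "n\<^sub>1\<^sup>2 \<le> n\<^sub>2\<^sup>2" "n\<^sub>1\<^sup>2 * n\<^sub>2\<^sup>2 \<le> 4 / 3"
    using le prod by (simp_all add: n\<^sub>1_def n\<^sub>2_def mult_ac)
  have n0: "0 \<le> n\<^sub>1" "0 \<le> n\<^sub>2" by (simp_all add: n\<^sub>1_def n\<^sub>2_def)
  have "n\<^sub>1 \<le> n\<^sub>2" using n12(1) n0 by (simp add: power2_le_iff_abs_le)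
  have "\<bar>1 / real_of_int x\<bar> \<le> K" using K(1) assms(2) by (simp add: field_simps order_trans)
  then have coeffs: "\<bar>1 / real_of_int x\<bar> \<le> K" "\<bar>- 1\<bar> \<le> K" "\<bar>0\<bar> \<le> K" "\<bar>D\<bar> \<le> K" "\<bar>E\<bar> \<le> K"
    using K DE by auto
  have comps: "\<bar>\<mu> * p + x / \<mu> * r\<bar> \<le> n\<^sub>1" "\<bar>0 * real_of_int p + 1 / \<mu> * r\<bar> \<le> n\<^sub>1"
    "\<bar>\<mu> * q + x / \<mu> * s\<bar> \<le> n\<^sub>2" "\<bar>0 * real_of_int q + 1 / \<mu> * s\<bar> \<le> n\<^sub>2"
    unfolding n\<^sub>1_def n\<^sub>2_def
    by (rule real_sqrt_ge_abs1 real_sqrt_ge_abs2)+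
  note bound = qf_act_bound[OF coeffs comps h']
  have inv: "qf_I (a, b, c, d, e) = g\<^sub>2" "qf_J (a, b, c, d, e) = g\<^sub>3"
  proof -
    show "qf_I (a, b, c, d, e) = g\<^sub>2" unfolding h[symmetric] qf_I_act det by simp
    have "qf_J (1, 0, - x, y, g\<^sub>2 - 3 * x\<^sup>2) = g\<^sub>3"
      using curve by (simp add: algebra_simps power_numeral_reduce)
    then show "qf_J (a, b, c, d, e) = g\<^sub>3" unfolding h[symmetric] qf_J_act det by simp
  qed
  have "n\<^sub>1\<^sup>2 \<ge> 1 / (32 * K)"
  proof (rule ccontr)
    assume "\<not> ?thesis"
    then have small: "n\<^sub>1\<^sup>2 * (32 * K) < 1" using K by (simp add: field_simps)
    then have small': "16 * K * (n\<^sub>1\<^sup>2 * 2) < 1" by (simp add: mult_ac)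
    have "n\<^sub>1\<^sup>2 * 1 \<le> n\<^sub>1\<^sup>2 * (32 * K)" using K by (intro mult_left_mono) auto
    then have n1: "n\<^sub>1\<^sup>2 \<le> 1" using small by linarith
    have "n\<^sub>1 ^ 4 = n\<^sub>1\<^sup>2 * n\<^sub>1\<^sup>2" by (simp add: power_numeral_reduce)
    also have "\<dots> \<le> n\<^sub>1\<^sup>2 * 2" using n1 by (intro mult_left_mono) auto
    finally have "16 * K * n\<^sub>1 ^ 4 \<le> 16 * K * (n\<^sub>1\<^sup>2 * 2)" using K by (intro mult_left_mono) auto
    then have "\<bar>real_of_int a\<bar> < 1" using bound(1) small' by linarith
    then have "a = 0" by linarith
    have "(n\<^sub>1 * n\<^sub>2)\<^sup>2 \<le> 2\<^sup>2" using n12(2) by (simp add: power_mult_distrib)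
    then have "n\<^sub>1 * n\<^sub>2 \<le> 2" by (rule power2_le_imp_le) simp
    then have "n\<^sub>1\<^sup>2 * (n\<^sub>1 * n\<^sub>2) \<le> n\<^sub>1\<^sup>2 * 2" by (intro mult_left_mono) auto
    then have "n\<^sub>1 ^ 3 * n\<^sub>2 \<le> n\<^sub>1\<^sup>2 * 2" by (simp add: power_numeral_reduce)
    then have "16 * K * (n\<^sub>1 ^ 3 * n\<^sub>2) \<le> 16 * K * (n\<^sub>1\<^sup>2 * 2)" using K by (intro mult_left_mono) auto
    then have "\<bar>real_of_int b\<bar> < 1" using bound(2) small' by linarith
    then have "b = 0" by linarith
    have "g\<^sub>2 = 3 * c\<^sup>2" "g\<^sub>3 = - (c ^ 3)" using inv \<open>a = 0\<close> \<open>b = 0\<close> by simp_all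
    then have "g\<^sub>2 ^ 3 = 27 * g\<^sub>3 ^ 2" by (simp add: power_mult_distrib power_mult[symmetric])
    then show False using disc by simp
  qed
  then have "(1 / (32 * K)) * n\<^sub>2\<^sup>2 \<le> n\<^sub>1\<^sup>2 * n\<^sub>2\<^sup>2" by (intro mult_right_mono) auto
  then have "(1 / (32 * K)) * n\<^sub>2\<^sup>2 \<le> 4 / 3" using n12(2) by linarith
  then have n2: "n\<^sub>2\<^sup>2 \<le> 64 * K" using K by (simp add: field_simps)
  have n2': "n\<^sub>2 ^ 4 \<le> (64 * K)\<^sup>2"
  proof -
    have "n\<^sub>2 ^ 4 = (n\<^sub>2\<^sup>2)\<^sup>2" by simp
    also have "\<dots> \<le> (64 * K)\<^sup>2" using n2 by (intro power_mono) auto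
    finally show ?thesis .
  qed
  have final: "\<bar>z\<bar> \<le> 16 * K * (64 * K)\<^sup>2" if "\<bar>z\<bar> \<le> 16 * K * m" "m \<le> n\<^sub>2 ^ 4" for z m :: real
  proof -
    have "16 * K * m \<le> 16 * K * (64 * K)\<^sup>2" using that n2' K by (intro mult_left_mono) auto
    then show ?thesis using that by linarith
  qed
  have "n\<^sub>1 ^ 4 \<le> n\<^sub>2 ^ 4" "n\<^sub>1 ^ 3 * n\<^sub>2 \<le> n\<^sub>2 ^ 3 * n\<^sub>2" "n\<^sub>1\<^sup>2 * n\<^sub>2\<^sup>2 \<le> n\<^sub>2\<^sup>2 * n\<^sub>2\<^sup>2" "n\<^sub>1 * n\<^sub>2 ^ 3 \<le> n\<^sub>2 * n\<^sub>2 ^ 3"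
    using n0 \<open>n\<^sub>1 \<le> n\<^sub>2\<close> by (intro mult_right_mono power_mono; simp)+
  then have "n\<^sub>1 ^ 4 \<le> n\<^sub>2 ^ 4" "n\<^sub>1 ^ 3 * n\<^sub>2 \<le> n\<^sub>2 ^ 4" "n\<^sub>1\<^sup>2 * n\<^sub>2\<^sup>2 \<le> n\<^sub>2 ^ 4" "n\<^sub>1 * n\<^sub>2 ^ 3 \<le> n\<^sub>2 ^ 4"
    by (simp_all add: power_numeral_reduce)
  then have "\<forall>z\<in>{a, b, c, d, e}. \<bar>real_of_int z\<bar> \<le> 16 * K * (64 * K)\<^sup>2"
    using final[OF bound(1)] final[OF bound(2)] final[OF bound(3)] final[OF bound(4)] final[OF bound(5)]
    by simp
  then show thesis using that[OF det h] inv by blast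
qed

text \<open>The hypothesis says that the cubic has no multiple root. The attached quartics have the
  same \<open>g\<^sub>2\<close> and \<open>g\<^sub>3\<close>, so it is also the nonvanishing of
  their discriminant that both the reduction and Thue's theorem demand. Far to the left the cubic is
  negative.\<close>

theorem finite_integral_points:
  fixes g\<^sub>2 g\<^sub>3 :: int
  assumes disc: "g\<^sub>2 ^ 3 \<noteq> 27 * g\<^sub>3 ^ 2"
  shows "finite {x. \<exists>y. y\<^sup>2 = 4 * x ^ 3 - g\<^sub>2 * x - g\<^sub>3}"
proof -
  define G where "G = \<bar>real_of_int g\<^sub>2\<bar> + \<bar>real_of_int g\<^sub>3\<bar>"
  define K where "K = 1 + G + G * G + 4 * G"
  define B where "B = \<lceil>16 * K * (64 * K)\<^sup>2\<rceil>"
  define C where "C = {- B..B}"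
  define F where "F = {h \<in> C \<times> C \<times> C \<times> C \<times> C. qf_I h = g\<^sub>2 \<and> qf_J h = g\<^sub>3}"
  define T where "T = (\<Union>h\<in>F. (\<lambda>(p, q). - qf_hessian h p q) ` {(p, q). qf_eval h p q = 1})"
  have "finite F" unfolding F_def C_def by (intro finite_Collect_conjI disjI1) simp
  then have "finite T" unfolding T_def F_def using disc by (intro finite_UN_I finite_imageI thue_quartic) auto
  have "{x. \<exists>y. y\<^sup>2 = 4 * x ^ 3 - g\<^sub>2 * x - g\<^sub>3} \<subseteq> {- (\<bar>g\<^sub>2\<bar> + \<bar>g\<^sub>3\<bar>)..0} \<union> T"
  proof clarify
    fix x y assume y: "y\<^sup>2 = 4 * x ^ 3 - g\<^sub>2 * x - g\<^sub>3" and xT: "x \<notin> T"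
    have "\<not> x \<ge> 1"
    proof
      assume x: "x \<ge> 1"
      \<comment> \<open>The sign of \<open>y\<close> is free; the nonpositive choice puts the triple
        cluster of roots near \<open>- sqrt x\<close>.\<close>
      have "(- \<bar>y\<bar>)\<^sup>2 = 4 * x ^ 3 - g\<^sub>2 * x - g\<^sub>3" "- \<bar>y\<bar> \<le> 0" using y by simp_all
      from reduced_mordell_quartic[OF this(1) x this(2) disc]
      obtain p q r s a b c d e :: int where det: "p * s - q * r = 1"
        and h: "qf_act (1, 0, - x, - \<bar>y\<bar>, g\<^sub>2 - 3 * x\<^sup>2) p q r s = (a, b, c, d, e)"
        and bd: "\<forall>z\<in>{a, b, c, d, e}. \<bar>real_of_int z\<bar> \<le> 16 * K * (64 * K)\<^sup>2"
        and inv: "qf_I (a, b, c, d, e) = g\<^sub>2" "qf_J (a, b, c, d, e) = g\<^sub>3"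
        unfolding G_def[symmetric] K_def[symmetric] by metis
      have "z \<in> C" if "z \<in> {a, b, c, d, e}" for z
      proof -
        have "\<bar>real_of_int z\<bar> \<le> of_int B" using bd that unfolding B_def by (meson le_of_int_ceiling order_trans)
        then have "\<bar>z\<bar> \<le> B" by (metis of_int_abs of_int_le_iff)
        then show ?thesis by (simp add: C_def abs_le_iff)
      qed
      then have "(a, b, c, d, e) \<in> F" using inv by (simp add: F_def)
      moreover have "qf_eval (a, b, c, d, e) s (- r) = 1"
        unfolding h[symmetric] qf_eval_act_inverse det by simp
      moreover have "- qf_hessian (a, b, c, d, e) s (- r) = x"
        unfolding h[symmetric] qf_hessian_act_inverse det by simp
      ultimately have "x \<in> T" unfolding T_def by (intro UN_I image_eqI[of _ _ "(s, - r)"]) auto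
      then show False using xT by simp
    qed
    moreover have "x \<ge> - (\<bar>g\<^sub>2\<bar> + \<bar>g\<^sub>3\<bar>)"
    proof (rule ccontr)
      define z where "z = - x"
      assume "\<not> ?thesis"
      then have z: "z > \<bar>g\<^sub>2\<bar> + \<bar>g\<^sub>3\<bar>" by (simp add: z_def)
      have "0 \<le> y\<^sup>2" by simp
      also have "y\<^sup>2 = - 4 * z ^ 3 + g\<^sub>2 * z - g\<^sub>3" using y by (simp add: z_def)
      also have "\<dots> \<le> - 4 * z ^ 3 + (\<bar>g\<^sub>2\<bar> + \<bar>g\<^sub>3\<bar>) * z"
      proof -
        have "g\<^sub>2 * z \<le> \<bar>g\<^sub>2\<bar> * z" using z by (intro mult_right_mono) auto
        moreover have "\<bar>g\<^sub>3\<bar> * 1 \<le> \<bar>g\<^sub>3\<bar> * z" using z by (intro mult_left_mono) auto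
        ultimately show ?thesis unfolding distrib_right by linarith
      qed
      also have "\<dots> \<le> - 4 * z ^ 3 + z * z" using z by (intro add_left_mono mult_right_mono) auto
      also have "\<dots> < 0"
      proof -
        have "z * z * 1 \<le> z * z * z" using z by (intro mult_left_mono) auto
        moreover have "z * z > 0" using z by (intro mult_pos_pos) auto
        ultimately show ?thesis by (simp add: power3_eq_cube)
      qed
      finally show False by simp
    qed
    ultimately show "x \<in> {- (\<bar>g\<^sub>2\<bar> + \<bar>g\<^sub>3\<bar>)..0}" by simp
  qed
  then show ?thesis using \<open>finite T\<close> by (meson finite_Un finite_atLeastAtMost_int finite_subset)
qed

section \<open>The case \<open>a\<close> congruent to 2 modulo 4\<close>

text \<open>The substitution \<open>x = 2 b X\<close>, \<open>y = 24 b M\<close> gives Weierstrass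
  form with integral \<open>g\<^sub>2\<close> and \<open>g\<^sub>3\<close>; the second hypothesis is
  the nonvanishing discriminant of \<open>X^3 - k X + e / b\<close>.\<close>

lemma finite_integral_points_shifted_cubic:
  fixes b e k :: int
  assumes "b \<noteq> 0" "e\<^sup>2 * 27 \<noteq> 4 * b\<^sup>2 * k ^ 3"
  shows "finite {X. \<exists>M. 18 * M\<^sup>2 = b * (X ^ 3 - k * X) + e}"
proof -
  define g\<^sub>2 where "g\<^sub>2 = 16 * b\<^sup>2 * k"
  define g\<^sub>3 where "g\<^sub>3 = - 32 * b\<^sup>2 * e"
  have "g\<^sub>2 ^ 3 \<noteq> 27 * g\<^sub>3\<^sup>2"
  proof
    assume "g\<^sub>2 ^ 3 = 27 * g\<^sub>3\<^sup>2"
    moreover have "g\<^sub>2 ^ 3 = (1024 * b ^ 4) * (4 * b\<^sup>2 * k ^ 3)"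
      unfolding g\<^sub>2_def by (simp add: algebra_simps power_numeral_reduce)
    moreover have "27 * g\<^sub>3\<^sup>2 = (1024 * b ^ 4) * (e\<^sup>2 * 27)"
      unfolding g\<^sub>3_def by (simp add: algebra_simps power_numeral_reduce)
    ultimately have "(1024 * b ^ 4) * (4 * b\<^sup>2 * k ^ 3) = (1024 * b ^ 4) * (e\<^sup>2 * 27)" by simp
    then show False using assms unfolding mult_cancel_left by simp
  qed
  then have "finite {x. \<exists>y. y\<^sup>2 = 4 * x ^ 3 - g\<^sub>2 * x - g\<^sub>3}" by (rule finite_integral_points)
  moreover have "(\<lambda>X. 2 * b * X) ` {X. \<exists>M. 18 * M\<^sup>2 = b * (X ^ 3 - k * X) + e} \<subseteq> {x. \<exists>y. y\<^sup>2 = 4 * x ^ 3 - g\<^sub>2 * x - g\<^sub>3}"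
  proof clarify
    fix X M assume M: "18 * M\<^sup>2 = b * (X ^ 3 - k * X) + e"
    have "(24 * b * M)\<^sup>2 = 32 * b\<^sup>2 * (18 * M\<^sup>2)" by (simp add: power_mult_distrib)
    also have "\<dots> = 4 * (2 * b * X) ^ 3 - g\<^sub>2 * (2 * b * X) - g\<^sub>3"
      unfolding M g\<^sub>2_def g\<^sub>3_def by (simp add: algebra_simps power_numeral_reduce)
    finally show "\<exists>y. y\<^sup>2 = 4 * (2 * b * X) ^ 3 - g\<^sub>2 * (2 * b * X) - g\<^sub>3" by blast
  qed
  ultimately have "finite ((\<lambda>X. 2 * b * X) ` {X. \<exists>M. 18 * M\<^sup>2 = b * (X ^ 3 - k * X) + e})"
    by (rule finite_subset[rotated])
  then show ?thesis by (rule finite_imageD) (use assms(1) in \<open>auto simp: inj_on_def\<close>)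
qed

text \<open>For \<open>k = 3\<close> and \<open>k = 12\<close> the number \<open>4 k^3 / 27\<close>
  is a square, 4 or 256. On a singular curve \<open>b c + 18 t^2\<close> would be \<open>2 b\<close>
  or \<open>16 b\<close> up to sign, making \<open>18 t^2\<close> equal to \<open>b\<close> times a
  multiple of 4; but \<open>18 t^2 mod 4 = 2\<close> for odd \<open>t\<close>.\<close>

lemma partition_curve_nonsingular:
  fixes b t c k :: int
  assumes "odd t" "odd b" and kc: "k = 3 \<and> c mod 4 = 2 \<or> k = 12 \<and> 16 dvd c"
  shows "(b * c + 18 * t\<^sup>2)\<^sup>2 * 27 \<noteq> 4 * b\<^sup>2 * k ^ 3"
proof
  assume eq: "(b * c + 18 * t\<^sup>2)\<^sup>2 * 27 = 4 * b\<^sup>2 * k ^ 3"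
  have t: "(18 * t\<^sup>2) mod 4 = 2"
  proof -
    obtain u where "t = 2 * u + 1" using assms(1) by (elim oddE)
    then have "18 * t\<^sup>2 = 2 + 4 * (18 * u\<^sup>2 + 18 * u + 4)" by (simp add: power2_eq_square algebra_simps)
    then show ?thesis by (simp only: mod_mult_self2) simp
  qed
  from kc have "4 dvd 18 * t\<^sup>2"
  proof
    assume k: "k = 3 \<and> c mod 4 = 2"
    then have "(b * c + 18 * t\<^sup>2)\<^sup>2 = (2 * b)\<^sup>2" using eq by simp
    then have "b * c + 18 * t\<^sup>2 = 2 * b \<or> b * c + 18 * t\<^sup>2 = - (2 * b)" by (simp only: power2_eq_iff)
    then have "18 * t\<^sup>2 = b * (2 - c) \<or> 18 * t\<^sup>2 = - (b * (2 + c))" by (auto simp: algebra_simps)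
    moreover have "4 dvd 2 - c" "4 dvd 2 + c" using k by presburger+
    ultimately show ?thesis by (metis dvd_minus_iff dvd_mult)
  next
    assume k: "k = 12 \<and> 16 dvd c"
    then have "(b * c + 18 * t\<^sup>2)\<^sup>2 = (16 * b)\<^sup>2" using eq by simp
    then have "b * c + 18 * t\<^sup>2 = 16 * b \<or> b * c + 18 * t\<^sup>2 = - (16 * b)" by (simp only: power2_eq_iff)
    then have "18 * t\<^sup>2 = b * (16 - c) \<or> 18 * t\<^sup>2 = - (b * (16 + c))" by (auto simp: algebra_simps)
    moreover have "4 dvd 16 - c" "4 dvd 16 + c" using k by presburger+
    ultimately show ?thesis by (metis dvd_minus_iff dvd_mult)
  qed
  then show False using t by presburger
qed

lemma finitely_many_solutions:
  fixes b :: nat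
  assumes b: "odd b" "b \<ge> 3"
  shows "finite {(m, n). partition_count {1, 2, 2 * b} m = partition_count_upto 4 n}" (is "finite ?S")
proof -
  define I where "I = {(t, c :: int, k :: int). odd t \<and> \<bar>t\<bar> \<le> int b \<and> \<bar>c\<bar> \<le> 34 \<and>
    (k = 3 \<and> c mod 4 = 2 \<or> k = 12 \<and> 16 dvd c)}"
  define F where "F = (\<lambda>(t, c, k). {X. \<exists>M. 18 * M\<^sup>2 = int b * (X ^ 3 - k * X) + (int b * c + 18 * t\<^sup>2)})"
  have "I \<subseteq> {- int b..int b} \<times> {- 34..34} \<times> {3, 12}" by (auto simp: I_def)
  then have "finite I" by (rule finite_subset) simp
  have "finite (F i)" if "i \<in> I" for i
  proof -
    obtain t c k where i: "i = (t, c, k)" by (cases i)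
    have "odd t" "odd (int b)" "k = 3 \<and> c mod 4 = 2 \<or> k = 12 \<and> 16 dvd c"
      using that b by (simp_all add: i I_def)
    then show ?thesis
      unfolding F_def i prod.case using b
      by (intro finite_integral_points_shifted_cubic partition_curve_nonsingular) auto
  qed
  then have finF: "finite (\<Union>i\<in>I. F i)" using \<open>finite I\<close> by blast
  have n_in: "int n + 5 \<in> (\<Union>i\<in>I. F i)" if "(m, n) \<in> ?S" for m n
  proof -
    let ?P = "int (partition_count_upto 4 n)"
    obtain t where t: "odd t" "\<bar>t\<bar> \<le> int b" "8 * int b * ?P + t\<^sup>2 = (2 * int (m div 2) + 2 + int b)\<^sup>2"
      using partition_count_12a_diff_squares[OF b, of m] \<open>(m, n) \<in> ?S\<close> by auto
    obtain c k where ck: "\<bar>c\<bar> \<le> 34" "k = 3 \<and> c mod 4 = 2 \<or> k = 12 \<and> 16 dvd c"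
      "144 * ?P = (int n + 5) ^ 3 - k * (int n + 5) + c"
      using partition_count_upto_4_even[of n] partition_count_upto_4_odd[of n] by (cases "even n") blast+
    \<comment> \<open>The factor 18 is \<open>144 / 8\<close>, the quotient of the normalizations of
      the two counting functions.\<close>
    have "18 * (2 * int (m div 2) + 2 + int b)\<^sup>2 = int b * (144 * ?P) + 18 * t\<^sup>2"
      unfolding t(3)[symmetric] by (simp add: algebra_simps)
    also have "\<dots> = int b * ((int n + 5) ^ 3 - k * (int n + 5)) + (int b * c + 18 * t\<^sup>2)"
      unfolding ck(3) by (simp add: algebra_simps)
    finally have "int n + 5 \<in> F (t, c, k)" unfolding F_def by blast
    moreover have "(t, c, k) \<in> I" using t ck by (simp add: I_def)
    ultimately show ?thesis by blast
  qed
  define N where "N = {n. int n + 5 \<in> (\<Union>i\<in>I. F i)}"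
  have "finite N"
  proof (rule finite_imageD)
    show "finite ((\<lambda>n. int n + 5) ` N)" by (rule finite_subset[OF _ finF]) (auto simp: N_def)
  qed (simp add: inj_on_def)
  \<comment> \<open>Finitely many \<open>n\<close> suffice: \<open>P_A(m)\<close> is at least
    \<open>m div 2 + 1\<close>, so the common value bounds \<open>m\<close>.\<close>
  moreover have "?S \<subseteq> (\<Union>n\<in>N. {..2 * partition_count_upto 4 n} \<times> {n})"
  proof clarify
    fix m n assume eq: "partition_count {1, 2, 2 * b} m = partition_count_upto 4 n"
    then have "n \<in> N" using n_in[of m n] by (simp add: N_def)
    moreover have "m div 2 + 1 \<le> partition_count {1, 2, 2 * b} m"
      using partition_count_12a_ge[of "2 * b" m] b by simp
    then have "m \<le> 2 * partition_count_upto 4 n" unfolding eq by linarith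
    ultimately show "(m, n) \<in> (\<Union>n\<in>N. {..2 * partition_count_upto 4 n} \<times> {n})" by blast
  qed
  ultimately show ?thesis by (auto intro: finite_subset)
qed

theorem theorem4p3:
  fixes a :: nat
  assumes "a \<ge> 3"
  shows "(\<not> [a = 2] (mod 4) \<longrightarrow>
            infinite {(m :: nat, n :: nat). m > 0 \<and> n > 0 \<and>
              partition_count {1, 2, a} m = partition_count_upto 4 n})
       \<and> ([a = 2] (mod 4) \<longrightarrow>
            finite {(m :: nat, n :: nat).
              partition_count {1, 2, a} m = partition_count_upto 4 n})"
proof (intro conjI impI)
  assume "\<not> [a = 2] (mod 4)"
  then show "infinite {(m :: nat, n :: nat). m > 0 \<and> n > 0 \<and>
              partition_count {1, 2, a} m = partition_count_upto 4 n}"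
    by (rule infinitely_many_solutions[OF assms])
next
  assume "[a = 2] (mod 4)"
  then have "a mod 4 = 2" by (simp add: cong_def)
  define b where "b = a div 2"
  have "odd b" "b \<ge> 3" "a = 2 * b" using assms \<open>a mod 4 = 2\<close> unfolding b_def by presburger+
  then show "finite {(m :: nat, n :: nat). partition_count {1, 2, a} m = partition_count_upto 4 n}"
    using finitely_many_solutions by simp
qed

end
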